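(* Let $t>0$ and let $\Gamma$ be a smooth curve as in the context. With respect to the orthonormal frame $\{Y_1,Y_2,Y_3\}$ on $M^3_\Gamma\cap M^4$, the Ricci tensor of $(M^3_\Gamma,h_t)$ is $$\mathrm{Ric}=\frac{1}{2\big(\rho^4(r^2+1)^2+t^4\big)^{3/2}}\begin{pmatrix}2t^4&0&0\\0&2t^4-\rho^4(r^2+1)^2&0\\0&0&-4t^4-\rho^4(r^2+1)^2\end{pmatrix},$$ and the scalar curvature is $$S=-\frac{\rho^4(r^2+1)^2}{\big(\rho^4(r^2+1)^2+t^4\big)^{3/2}}.$$
   Context: Eguchi--Hanson space: $T^*\mathbb P^1(\mathbb C)$ is realized as $H^2=\{(\alpha,\beta,\gamma)\in(\mathbb C^2\setminus\{0\})\times\mathbb C\}/\sim$, where $(\alpha,\beta,\gamma)\sim(A\alpha,A\beta,\gamma/A^2)$ for $A\in\mathbb C^*$; the projection is $p([\alpha,\beta,\gamma])=\alpha/\beta\in\mathbb C\cup\{\infty\}=\mathbb P^1(\mathbb C)$. $M^4\subset H^2$ is the complement of the zero section $\{\gamma=0\}$, identified with $(\mathbb C^2\setminus\{0\})/\{\pm1\}$ by $[\alpha,\beta,\gamma]\mapsto \pm(z_1,z_2)=\pm(\alpha\sqrt\gamma,\beta\sqrt\gamma)$. Put $u_1=|z_1|^2+|z_2|^2$ and $f_t=\sqrt{u_1^2+t^4}+t^2\log\frac{u_1}{\sqrt{u_1^2+t^4}+t^2}$. The form $\omega_t=i\partial\bar\partial f_t$ extends to a Kähler form on $H^2$, and $g_t(X,Y)=\omega_t(X,JY)$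 is the Eguchi--Hanson metric ($J$ the complex structure). Hypersurfaces: $\Gamma(s)=u(s)+iv(s)=r(s)e^{i\phi_\Gamma(s)}$ is a smooth curve in $\mathbb C$ parametrized by Euclidean arc length ($\dot u^2+\dot v^2=1$), $M^3_\Gamma=p^{-1}(\Gamma)\subset H^2$, and $h_t$ is the metric induced by $g_t$. $M^3_\Gamma\cap M^4$ is parametrized by $(s,\rho,\phi)$, $\rho>0$, via $\Psi(s,\rho,\phi)=\pm\rho e^{i\phi}(\Gamma(s),1)$ in the coordinates $\pm(z_1,z_2)$. Frame: let $K=\frac{2\rho^2(r^2+1)}{\sqrt{\rho^4(r^2+1)^2+t^4}}$, $h_{12}=r\dot r\rho K$, $h_{13}=\dot\phi_\Gamma r^2\rho^2K$, $h_{22}=(r^2+1)K$, $h_{33}=\rho^2(r^2+1)K$ (components of $h_t$ in the coordinates $(s,\rho,\phi)$), $\Sigma=\rho/\sqrt{\det h_t}=1/(2\rho\sqrt{h_{22}})$, $D=h_{22}\Sigma$, $E=-h_{12}\Sigma$, $F=-h_{13}\Sigma/\rho^2$. The orthonormal frame is $Y_1=h_{22}^{-1/2}\partial_\rho$, $Y_2=h_{33}^{-1/2}\partial_\phi$, $Y_3=D\partial_s+E\partial_\rho+F\partial_\phi$. *)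

theory Defs
  imports "HOL-Analysis.Analysis"
begin

section \<open>Directional derivatives and smooth curves\<close>

definition dir_deriv :: "('a::real_normed_vector \<Rightarrow> 'b::real_normed_vector) \<Rightarrow> 'a \<Rightarrow> 'a \<Rightarrow> 'b"
  where "dir_deriv F x v = vector_derivative (\<lambda>\<tau>::real. F (x + \<tau> *\<^sub>R v)) (at 0)"

definition smooth_on :: "real set \<Rightarrow> (real \<Rightarrow> 'a::real_normed_vector) \<Rightarrow> bool"
  where "smooth_on I c \<longleftrightarrow>
    (\<forall>n. \<forall>s\<in>I. ((\<lambda>f s. vector_derivative f (at s)) ^^ n) c differentiable (at s))"

section \<open>The Eguchi--Hanson metric\<close>

text \<open>
  The complement \<open>M\<^sup>4\<close> of the zero section is \<open>(\<complex>\<^sup>2 - {0}) / {\<plusminus>1}\<close>. All objects below are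
  invariant under \<open>z \<mapsto> -z\<close> and are written on the double cover \<open>\<complex>\<^sup>2 - {0}\<close>; a point
  \<open>z\<close> there stands for the class of \<open>(z\<^sub>1, z\<^sub>2, 1)\<close> in \<open>H\<^sup>2\<close>, so that \<open>p\<close> becomes
  \<open>z\<^sub>1 / z\<^sub>2\<close>. The complex structure \<open>J\<close> is multiplication by \<open>\<i>\<close>.
\<close>

definition EH_potential :: "real \<Rightarrow> complex^2 \<Rightarrow> real"
  where "EH_potential t z =
    (let u1 = (cmod (z$1))\<^sup>2 + (cmod (z$2))\<^sup>2; q = sqrt (u1\<^sup>2 + t^4)
     in q + t\<^sup>2 * ln (u1 / (q + t\<^sup>2)))"

definition wirtinger :: "'n::finite \<Rightarrow> (complex^'n \<Rightarrow> complex) \<Rightarrow> complex^'n \<Rightarrow> complex"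
  where "wirtinger j F z = (dir_deriv F z (axis j 1) - \<i> * dir_deriv F z (axis j \<i>)) / 2"

definition wirtinger_bar :: "'n::finite \<Rightarrow> (complex^'n \<Rightarrow> complex) \<Rightarrow> complex^'n \<Rightarrow> complex"
  where "wirtinger_bar k F z = (dir_deriv F z (axis k 1) + \<i> * dir_deriv F z (axis k \<i>)) / 2"

text \<open>
  The form \<open>\<i> \<partial>\<partial>\<^sup>-f = \<i> \<Sum> (\<partial>\<^sub>j \<partial>\<^sup>-\<^sub>k f) dz\<^sub>j \<and> dz\<^sup>-\<^sub>k\<close> evaluated on two tangent vectors at \<open>z\<close>,
  with the convention \<open>(\<alpha> \<and> \<beta>)(X, Y) = \<alpha>(X) \<beta>(Y) - \<alpha>(Y) \<beta>(X)\<close>. For \<open>f = \<bar>z\<bar>\<^sup>2\<close> the associated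
  metric is twice the Euclidean one.
\<close>

definition i_ddbar :: "(complex^'n \<Rightarrow> complex) \<Rightarrow> complex^'n::finite \<Rightarrow> complex^'n \<Rightarrow> complex^'n \<Rightarrow> complex"
  where "i_ddbar f z X Y =
    \<i> * (\<Sum>j\<in>UNIV. \<Sum>k\<in>UNIV. wirtinger j (wirtinger_bar k f) z
            * (X$j * cnj (Y$k) - Y$j * cnj (X$k)))"

definition EH_form :: "real \<Rightarrow> complex^2 \<Rightarrow> complex^2 \<Rightarrow> complex^2 \<Rightarrow> complex"
  where "EH_form t = i_ddbar (\<lambda>z. complex_of_real (EH_potential t z))"

text \<open>The form is real, so taking the real part only changes the type.\<close>

definition EH_metric :: "real \<Rightarrow> complex^2 \<Rightarrow> complex^2 \<Rightarrow> complex^2 \<Rightarrow> real"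
  where "EH_metric t z X Y = Re (EH_form t z X (\<i> *s Y))"

section \<open>The hypersurface and its induced metric\<close>

text \<open>The coordinates are \<open>x = (s, \<rho>, \<phi>)\<close>.\<close>

definition Psi :: "(real \<Rightarrow> complex) \<Rightarrow> real^3 \<Rightarrow> complex^2"
  where "Psi \<Gamma> x = (complex_of_real (x$2) * cis (x$3)) *s vector [\<Gamma> (x$1), 1]"

lemma Psi_image:
  "Psi \<Gamma> ` {x. x$1 \<in> I \<and> x$2 > 0} = {z. z$2 \<noteq> 0 \<and> z$1 / z$2 \<in> \<Gamma> ` I}"
proof (intro set_eqI iffI)
  fix z assume "z \<in> Psi \<Gamma> ` {x. x$1 \<in> I \<and> x$2 > 0}"
  then show "z \<in> {z. z$2 \<noteq> 0 \<and> z$1 / z$2 \<in> \<Gamma> ` I}"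
    by (auto simp: Psi_def)
next
  fix z :: "complex^2" assume "z \<in> {z. z$2 \<noteq> 0 \<and> z$1 / z$2 \<in> \<Gamma> ` I}"
  then obtain s where s: "s \<in> I" "z$1 / z$2 = \<Gamma> s" and z2: "z$2 \<noteq> 0" by auto
  let ?x = "vector [s, cmod (z$2), Arg (z$2)] :: real^3"
  have "complex_of_real (cmod (z$2)) * cis (Arg (z$2)) = z$2"
    using rcis_cmod_Arg[of "z$2"] by (simp add: rcis_def)
  moreover have "z$1 = z$2 * \<Gamma> s" using s(2) z2 by (simp add: field_simps)
  ultimately have "z = Psi \<Gamma> ?x"
    by (simp add: Psi_def vec_eq_iff forall_2)
  then show "z \<in> Psi \<Gamma> ` {x. x$1 \<in> I \<and> x$2 > 0}"
    using s(1) z2 by (intro image_eqI[of _ _ ?x]) auto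
qed

definition induced_metric :: "real \<Rightarrow> (real \<Rightarrow> complex) \<Rightarrow> real^3 \<Rightarrow> real^3^3"
  where "induced_metric t \<Gamma> x =
    (\<chi> i j. EH_metric t (Psi \<Gamma> x) (dir_deriv (Psi \<Gamma>) x (axis i 1)) (dir_deriv (Psi \<Gamma>) x (axis j 1)))"

section \<open>Curvature of a metric given by its coordinate matrix\<close>

definition metric_form :: "(real^'n \<Rightarrow> real^'n^'n) \<Rightarrow> real^'n \<Rightarrow> real^'n \<Rightarrow> real^'n \<Rightarrow> real"
  where "metric_form G x X Y = (\<Sum>i\<in>UNIV. \<Sum>j\<in>UNIV. G x $ i $ j * X$i * Y$j)"

text \<open>\<open>christoffel G k i j x\<close> is the coefficient of \<open>\<partial>\<^sub>k\<close> in \<open>\<nabla>\<^sub>i \<partial>\<^sub>j\<close>.\<close>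

definition christoffel :: "(real^'n \<Rightarrow> real^'n^'n) \<Rightarrow> 'n::finite \<Rightarrow> 'n \<Rightarrow> 'n \<Rightarrow> real^'n \<Rightarrow> real"
  where "christoffel G k i j x =
    (\<Sum>l\<in>UNIV. matrix_inv (G x) $ k $ l *
       (dir_deriv (\<lambda>y. G y $ j $ l) x (axis i 1)
      + dir_deriv (\<lambda>y. G y $ i $ l) x (axis j 1)
      - dir_deriv (\<lambda>y. G y $ i $ j) x (axis l 1))) / 2"

text \<open>
  \<open>riemann G l k i j x\<close> is the coefficient of \<open>\<partial>\<^sub>l\<close> in \<open>R(\<partial>\<^sub>i, \<partial>\<^sub>j) \<partial>\<^sub>k\<close>, where
  \<open>R(X, Y) = \<nabla>\<^sub>X \<nabla>\<^sub>Y - \<nabla>\<^sub>Y \<nabla>\<^sub>X - \<nabla>\<^bsub>[X,Y]\<^esub>\<close>; the Ricci tensor \<open>Ric(Y, Z)\<close> is the trace of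
  \<open>X \<mapsto> R(X, Y) Z\<close>, which is positive on round spheres.
\<close>

definition riemann :: "(real^'n \<Rightarrow> real^'n^'n) \<Rightarrow> 'n::finite \<Rightarrow> 'n \<Rightarrow> 'n \<Rightarrow> 'n \<Rightarrow> real^'n \<Rightarrow> real"
  where "riemann G l k i j x =
      dir_deriv (christoffel G l j k) x (axis i 1) - dir_deriv (christoffel G l i k) x (axis j 1)
    + (\<Sum>m\<in>UNIV. christoffel G l i m x * christoffel G m j k x
                  - christoffel G l j m x * christoffel G m i k x)"

definition ricci_matrix :: "(real^'n \<Rightarrow> real^'n^'n) \<Rightarrow> real^'n \<Rightarrow> real^'n^'n::finite"
  where "ricci_matrix G x = (\<chi> j k. \<Sum>i\<in>UNIV. riemann G i k i j x)"

definition ricci :: "(real^'n \<Rightarrow> real^'n^'n) \<Rightarrow> real^'n \<Rightarrow> real^'n \<Rightarrow> real^'n \<Rightarrow> real"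
  where "ricci G x X Y = (\<Sum>j\<in>UNIV. \<Sum>k\<in>UNIV. ricci_matrix G x $ j $ k * X$j * Y$k)"

definition scalar_curvature :: "(real^'n \<Rightarrow> real^'n^'n) \<Rightarrow> real^'n \<Rightarrow> real"
  where "scalar_curvature G x =
    (\<Sum>j\<in>UNIV. \<Sum>k\<in>UNIV. matrix_inv (G x) $ j $ k * ricci_matrix G x $ j $ k)"

section \<open>The frame\<close>

text \<open>
  The frame is taken with respect to a smooth polar representation \<open>\<Gamma>(s) = r(s) cis (\<phi>\<^sub>\<Gamma>(s))\<close>.
  The radius \<open>r\<close> may be signed: this is what makes such a representation possible for curves
  through the origin.
\<close>

definition EH_K :: "real \<Rightarrow> (real \<Rightarrow> real) \<Rightarrow> real \<Rightarrow> real \<Rightarrow> real"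
  where "EH_K t r s \<rho> =
    2 * \<rho>\<^sup>2 * ((r s)\<^sup>2 + 1) / sqrt (\<rho>^4 * ((r s)\<^sup>2 + 1)\<^sup>2 + t^4)"

definition EH_frame ::
    "real \<Rightarrow> (real \<Rightarrow> complex) \<Rightarrow> (real \<Rightarrow> real) \<Rightarrow> (real \<Rightarrow> real) \<Rightarrow> real^3 \<Rightarrow> 3 \<Rightarrow> real^3"
  where "EH_frame t \<Gamma> r \<phi>\<^sub>\<Gamma> x =
    (let s = x$1; \<rho> = x$2;
         K = EH_K t r s \<rho>;
         h12 = r s * deriv r s * \<rho> * K;
         h13 = deriv \<phi>\<^sub>\<Gamma> s * (r s)\<^sup>2 * \<rho>\<^sup>2 * K;
         h22 = ((r s)\<^sup>2 + 1) * K;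
         h33 = \<rho>\<^sup>2 * ((r s)\<^sup>2 + 1) * K;
         \<Sigma> = \<rho> / sqrt (det (induced_metric t \<Gamma> x));
         D = h22 * \<Sigma>;
         E = - h12 * \<Sigma>;
         F = - h13 * \<Sigma> / \<rho>\<^sup>2;
         d_s = axis 1 1; d_rho = axis 2 1; d_phi = axis 3 1
     in (\<lambda>i. if i = 1 then (1 / sqrt h22) *\<^sub>R d_rho
             else if i = 2 then (1 / sqrt h33) *\<^sub>R d_phi
             else D *\<^sub>R d_s + E *\<^sub>R d_rho + F *\<^sub>R d_phi))"

end

theory Submission
  imports Defs
begin

text \<open>
  The potential is radial, \<open>f\<^sub>t = F(u)\<close> with \<open>F' = q / u\<close> and \<open>F'' = - t\<^sup>4 / (q u\<^sup>2)\<close>, where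
  \<open>q\<^sup>2 = u\<^sup>2 + t\<^sup>4\<close>; this makes \<open>g\<^sub>t\<close>, and then \<open>h\<^sub>t\<close>, explicit. In terms of \<open>u = \<rho>\<^sup>2 (r\<^sup>2 + 1)\<close> the
  induced metric is \<open>2 q \<alpha>\<^sup>2 + du\<^sup>2 / (2 q) + (2 u\<^sup>2 / q) \<beta>\<^sup>2\<close> with closed one-forms \<open>\<alpha>\<close>, \<open>\<beta>\<close>, so it is locally a
  diagonal metric whose coefficients depend on \<open>u\<close> only. Its Ricci tensor is therefore diagonal in the
  coframe \<open>(\<alpha>, du, \<beta>)\<close>, to which the given frame is dual up to scaling, and does not depend on the
  curvature of \<open>\<Gamma>\<close>.
\<close>

section \<open>Directional derivatives\<close>

text \<open>\<open>ricci\<close> is defined by a coordinate expression, so passing to coordinates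
  adapted to \<alpha>, u, \<beta> would require its invariance under a change of chart. Instead, the
  symbols obtained there are rewritten in (s, \<rho>, \<phi>) and merely verified, as polynomial
  identities. The curve enters through A, a, b and its signed curvature k, subject to A' = 2a, a' =
  1 - kb, b' = ka and a^2 + b^2 = A - 1; this system closes as long as k itself is not
  differentiated. The derivative k' could occur only in s-derivatives of symbols with both lower
  indices 1, and those drop out of the curvature before they have to be evaluated. Polar coordinates
  of \<Gamma> serve only to identify the frame, so a zero of r causes no division by zero.\<close>

lemma dir_deriv_eqI:
  assumes "((\<lambda>\<tau>. F (x + \<tau> *\<^sub>R v)) has_vector_derivative D) (at 0)"
  shows "dir_deriv F x v = D"
  using assms unfolding dir_deriv_def by (rule vector_derivative_at)

text \<open>The closed forms below are valid only on open sets (nonzero vectors, or the chart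
  \<open>U\<close>), so derivatives must be read off from identities that hold near the
  point.\<close>

lemma dir_deriv_eqI_local:
  assumes "open U" "x \<in> U" "\<And>y. y \<in> U \<Longrightarrow> F y = H y"
    and D: "((\<lambda>\<tau>. H (x + \<tau> *\<^sub>R v)) has_vector_derivative D) (at 0)"
  shows "dir_deriv F x v = D"
proof (rule dir_deriv_eqI)
  have "continuous_on UNIV (\<lambda>\<tau>::real. x + \<tau> *\<^sub>R v)" by (intro continuous_intros)
  then have "open ((\<lambda>\<tau>::real. x + \<tau> *\<^sub>R v) -` U)"
    using assms(1) by (simp add: continuous_on_open_vimage)
  moreover have "0 \<in> (\<lambda>\<tau>::real. x + \<tau> *\<^sub>R v) -` U" using assms(2) by simp
  ultimately show "((\<lambda>\<tau>. F (x + \<tau> *\<^sub>R v)) has_vector_derivative D) (at 0)"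
    using assms(3) by (intro has_vector_derivative_transform_within_open[OF D]) auto
qed

text \<open>Re-centring the line at the coordinate value \<open>x $ i\<close> gives an ordinary
  derivative in that variable, to which the usual derivative rules apply.\<close>

lemma dir_deriv_axis:
  fixes F :: "real^'n::finite \<Rightarrow> real"
  assumes "open U" "x \<in> U" "\<And>y. y \<in> U \<Longrightarrow> F y = H y"
    and D: "((\<lambda>c. H (x + (c - x $ i) *\<^sub>R axis i 1)) has_real_derivative D) (at (x $ i))"
  shows "dir_deriv F x (axis i 1) = D"
proof (rule dir_deriv_eqI_local[OF assms(1-3)])
  have "((\<lambda>\<tau>. H (x + ((x $ i + \<tau>) - x $ i) *\<^sub>R axis i 1)) has_real_derivative D) (at 0)"
    using D by (subst DERIV_at_within_shift[symmetric]) (simp add: add.commute)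
  then show "((\<lambda>\<tau>. H (x + \<tau> *\<^sub>R axis i 1)) has_vector_derivative D) (at 0)"
    by (simp add: has_real_derivative_iff_has_vector_derivative)
qed assumption

definition sqnorm :: "complex^'n::finite \<Rightarrow> real"
  where "sqnorm z = (\<Sum>j\<in>UNIV. (cmod (z $ j))\<^sup>2)"

lemma sqnorm_axis_line:
  fixes z :: "complex^'n::finite"
  shows "sqnorm (z + \<tau> *\<^sub>R axis k c) = sqnorm z + 2 * \<tau> * Re (cnj c * z $ k) + \<tau>\<^sup>2 * (cmod c)\<^sup>2"
proof -
  have "(cmod ((z + \<tau> *\<^sub>R axis k c) $ j))\<^sup>2 = (cmod (z $ j))\<^sup>2
     + (if j = k then 2 * \<tau> * Re (cnj c * z $ k) + \<tau>\<^sup>2 * (cmod c)\<^sup>2 else 0)" for j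
    unfolding cmod_power2 by (simp add: axis_def power2_eq_square algebra_simps)
  then show ?thesis by (simp add: sqnorm_def sum.distrib)
qed

lemma sqnorm_line_deriv:
  assumes "(F has_real_derivative F') (at (sqnorm z))"
  shows "((\<lambda>\<tau>. F (sqnorm (z + \<tau> *\<^sub>R axis k c))) has_real_derivative
     F' * (2 * Re (cnj c * z $ k))) (at 0)"
proof -
  have "((\<lambda>\<tau>. sqnorm (z + \<tau> *\<^sub>R axis k c)) has_real_derivative 2 * Re (cnj c * z $ k)) (at 0)"
    unfolding sqnorm_axis_line by (auto intro!: derivative_eq_intros)
  with assms show ?thesis
    by (intro DERIV_chain2[where f=F]) auto
qed

lemma open_sqnorm_pos: "open {z :: complex^'n::finite. sqnorm z > 0}"
  unfolding sqnorm_def by (intro open_Collect_less continuous_intros)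

section \<open>Complex Hessians of radial functions\<close>

text \<open>The directions 1 and \<i> contribute 2 F' Re z_k and 2 F' Im z_k. The result has the
  shape that \<open>wirtinger_radial_times\<close> differentiates next.\<close>

lemma wirtinger_bar_radial:
  fixes z :: "complex^'n::finite"
  assumes "sqnorm z > 0" "\<And>y. sqnorm y > 0 \<Longrightarrow> f y = complex_of_real (F (sqnorm y))"
    and "(F has_real_derivative F') (at (sqnorm z))"
  shows "wirtinger_bar k f z = F' * z $ k"
proof -
  have "dir_deriv f z (axis k c) = complex_of_real (F' * (2 * Re (cnj c * z $ k)))" for c
    using assms(1,2) sqnorm_line_deriv[OF assms(3)]
    by (intro dir_deriv_eqI_local[OF open_sqnorm_pos, where H="\<lambda>y. complex_of_real (F (sqnorm y))"]
          has_vector_derivative_of_real)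
      (auto simp del: of_real_mult simp: has_real_derivative_iff_has_vector_derivative)
  then show ?thesis
    by (simp add: wirtinger_bar_def complex_eq_iff)
qed

lemma wirtinger_radial_times:
  fixes z :: "complex^'n::finite"
  assumes "sqnorm z > 0" "\<And>y. sqnorm y > 0 \<Longrightarrow> f y = complex_of_real (F (sqnorm y)) * y $ k"
    and "(F has_real_derivative F') (at (sqnorm z))"
  shows "wirtinger j f z = F' * cnj (z $ j) * z $ k + complex_of_real (if j = k then F (sqnorm z) else 0)"
proof -
  have "dir_deriv f z (axis j c) =
      complex_of_real (F' * (2 * Re (cnj c * z $ j))) * z $ k
      + complex_of_real (F (sqnorm z)) * (axis j c $ k)" for c
  proof (rule dir_deriv_eqI_local[OF open_sqnorm_pos])
    have 1: "((\<lambda>\<tau>. complex_of_real (F (sqnorm (z + \<tau> *\<^sub>R axis j c)))) has_vector_derivative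
        complex_of_real (F' * (2 * Re (cnj c * z $ j)))) (at 0)"
      using sqnorm_line_deriv[OF assms(3)]
      by (intro has_vector_derivative_of_real) (simp add: has_real_derivative_iff_has_vector_derivative)
    have 2: "((\<lambda>\<tau>. (z + \<tau> *\<^sub>R axis j c) $ k) has_vector_derivative axis j c $ k) (at 0)"
      unfolding vector_add_component vector_scaleR_component
      by (auto intro!: derivative_eq_intros simp: has_vector_derivative_def)
    show "((\<lambda>\<tau>. complex_of_real (F (sqnorm (z + \<tau> *\<^sub>R axis j c))) * (z + \<tau> *\<^sub>R axis j c) $ k)
       has_vector_derivative complex_of_real (F' * (2 * Re (cnj c * z $ j))) * z $ k
      + complex_of_real (F (sqnorm z)) * (axis j c $ k)) (at 0)"
      using has_vector_derivative_mult[OF 1 2] by (simp add: add.commute)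
  qed (use assms(1,2) in auto)
  then show ?thesis
    by (auto simp add: wirtinger_def complex_eq_iff axis_def field_simps)
qed

text \<open>The Hessian is F'' times a rank one matrix built from z plus F' times the identity, so
  the double sum factors into Hermitian products with z.\<close>

lemma i_ddbar_radial:
  fixes z :: "complex^'n::finite"
  assumes "sqnorm z > 0" and f: "\<And>y. sqnorm y > 0 \<Longrightarrow> f y = complex_of_real (F (sqnorm y))"
    and F1: "\<And>u. u > 0 \<Longrightarrow> (F has_real_derivative F1 u) (at u)"
    and F2: "(F1 has_real_derivative F2) (at (sqnorm z))"
  shows "i_ddbar f z X Y = \<i> *
     (F2 * ((\<Sum>j\<in>UNIV. X $ j * cnj (z $ j)) * cnj (\<Sum>j\<in>UNIV. Y $ j * cnj (z $ j))
         - (\<Sum>j\<in>UNIV. Y $ j * cnj (z $ j)) * cnj (\<Sum>j\<in>UNIV. X $ j * cnj (z $ j)))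
     + F1 (sqnorm z) * (\<Sum>j\<in>UNIV. X $ j * cnj (Y $ j) - Y $ j * cnj (X $ j)))"
proof -
  have "wirtinger j (wirtinger_bar k f) z
     = F2 * cnj (z $ j) * z $ k + complex_of_real (if j = k then F1 (sqnorm z) else 0)" for j k
    by (rule wirtinger_radial_times[OF assms(1) _ F2], rule wirtinger_bar_radial[OF _ f F1])
  then have "i_ddbar f z X Y = \<i> * (\<Sum>j\<in>UNIV. \<Sum>k\<in>UNIV.
      F2 * ((X $ j * cnj (z $ j)) * (cnj (Y $ k) * z $ k) - (Y $ j * cnj (z $ j)) * (cnj (X $ k) * z $ k))
    + (if j = k then F1 (sqnorm z) * (X $ j * cnj (Y $ k) - Y $ j * cnj (X $ k)) else 0))"
    unfolding i_ddbar_def by (intro arg_cong[where f="\<lambda>v. \<i> * v"] sum.cong) (auto simp: algebra_simps)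
  also have "\<dots> = \<i> *
     (F2 * ((\<Sum>j\<in>UNIV. X $ j * cnj (z $ j)) * cnj (\<Sum>j\<in>UNIV. Y $ j * cnj (z $ j))
         - (\<Sum>j\<in>UNIV. Y $ j * cnj (z $ j)) * cnj (\<Sum>j\<in>UNIV. X $ j * cnj (z $ j)))
     + F1 (sqnorm z) * (\<Sum>j\<in>UNIV. X $ j * cnj (Y $ j) - Y $ j * cnj (X $ j)))"
    by (simp add: sum.distrib sum_subtractf sum_product flip: sum_distrib_left)
  finally show ?thesis .
qed

section \<open>The radial profile of the Eguchi-Hanson potential\<close>

lemma sqrt_sq_plus_deriv:
  fixes t v :: real
  assumes "v > 0"
  shows "((\<lambda>u. sqrt (u\<^sup>2 + t^4)) has_real_derivative v / sqrt (v\<^sup>2 + t^4)) (at v)"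
proof -
  have "v\<^sup>2 + t^4 > 0" using assms by (intro add_pos_nonneg) auto
  then have "(sqrt has_real_derivative inverse (sqrt (v\<^sup>2 + t^4)) / 2) (at (v\<^sup>2 + t^4))"
    by (rule DERIV_real_sqrt)
  moreover have "((\<lambda>u. u\<^sup>2 + t^4) has_real_derivative 2 * v) (at v)"
    by (auto intro!: derivative_eq_intros)
  ultimately have "((\<lambda>u. sqrt (u\<^sup>2 + t^4)) has_real_derivative
      inverse (sqrt (v\<^sup>2 + t^4)) / 2 * (2 * v)) (at v)"
    by (rule DERIV_chain2)
  moreover have "inverse w / 2 * (2 * v) = v / w" for w :: real by (simp add: field_simps)
  ultimately show ?thesis by (simp only:)
qed

text \<open>The logarithm is what makes u F' = q. The complex Hessian on C^2 then has eigenvalues F'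
  = q/u and (u F')' = u/q, hence determinant 1.\<close>

lemma EH_profile_deriv:
  fixes t v :: real
  assumes v: "v > 0"
  defines "Q \<equiv> \<lambda>u. sqrt (u\<^sup>2 + t^4)"
  shows "((\<lambda>u. Q u + t\<^sup>2 * ln (u / (Q u + t\<^sup>2))) has_real_derivative Q v / v) (at v)"
proof -
  define w y where "w = Q v" and "y = w + t\<^sup>2"
  have w2: "w\<^sup>2 = v\<^sup>2 + t^4" by (simp add: w_def Q_def)
  have "v\<^sup>2 + t^4 > 0" using v by (intro add_pos_nonneg) auto
  then have w: "w > 0" by (simp add: w_def Q_def)
  then have y: "y > 0" by (simp add: y_def add_pos_nonneg)
  have dQ: "(Q has_real_derivative v / w) (at v)"
    unfolding w_def Q_def by (rule sqrt_sq_plus_deriv[OF v])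
  have "((\<lambda>u. Q u + t\<^sup>2) has_real_derivative v / w + 0) (at v)"
    by (intro DERIV_add dQ DERIV_const)
  from DERIV_divide[OF DERIV_ident this]
  have "((\<lambda>u. u / (Q u + t\<^sup>2)) has_real_derivative (1 * y - v * (v / w)) / (y * y)) (at v)"
    using y by (simp add: y_def w_def)
  moreover have "(ln has_real_derivative 1 / (v / y)) (at (v / (Q v + t\<^sup>2)))"
    using DERIV_ln_divide[of "v / y"] v y by (simp add: y_def w_def)
  ultimately have "((\<lambda>u. ln (u / (Q u + t\<^sup>2))) has_real_derivative
      1 / (v / y) * ((1 * y - v * (v / w)) / (y * y))) (at v)"
    by (rule DERIV_chain2[rotated])
  then have "((\<lambda>u. Q u + t\<^sup>2 * ln (u / (Q u + t\<^sup>2))) has_real_derivative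
      v / w + t\<^sup>2 * (1 / (v / y) * ((1 * y - v * (v / w)) / (y * y)))) (at v)"
    by (rule DERIV_add[OF dQ DERIV_cmult])
  also have "v / w + t\<^sup>2 * (1 / (v / y) * ((1 * y - v * (v / w)) / (y * y)))
      = (v\<^sup>2 * y + t\<^sup>2 * (w * y - v\<^sup>2)) / (v * w * y)"
    using v w y by (simp add: divide_simps power2_eq_square)
  \<comment> \<open>Since t^4 = w^2 - v^2, both sides equal w^3 + t^2 w^2.\<close>
  also have "v\<^sup>2 * y + t\<^sup>2 * (w * y - v\<^sup>2) = w\<^sup>2 * y"
    using w2 y_def by algebra
  also have "w\<^sup>2 * y / (v * w * y) = Q v / v"
    using w y by (simp add: power2_eq_square flip: w_def)
  finally show ?thesis .
qed

lemma EH_profile_deriv2: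
  fixes t v :: real
  assumes v: "v > 0"
  defines "Q \<equiv> \<lambda>u. sqrt (u\<^sup>2 + t^4)"
  shows "((\<lambda>u. Q u / u) has_real_derivative - (t^4 / (Q v * v\<^sup>2))) (at v)"
proof -
  have Q2: "(Q v)\<^sup>2 = v\<^sup>2 + t^4" by (simp add: Q_def)
  have "v\<^sup>2 + t^4 > 0" using v by (intro add_pos_nonneg) auto
  then have Q: "Q v > 0" by (simp add: Q_def)
  have "((\<lambda>u. Q u / u) has_real_derivative (v / Q v * v - Q v * 1) / (v * v)) (at v)"
    unfolding Q_def using v by (intro DERIV_divide[OF sqrt_sq_plus_deriv DERIV_ident]) auto
  also have "(v / Q v * v - Q v * 1) / (v * v) = (v\<^sup>2 - (Q v)\<^sup>2) / (Q v * v\<^sup>2)"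
    using Q v by (simp add: field_simps power2_eq_square)
  also have "\<dots> = - (t^4 / (Q v * v\<^sup>2))" by (simp add: Q2)
  finally show ?thesis .
qed

text \<open>With \<open>\<i> *s Y\<close> as second argument each antisymmetric bracket becomes
  -\<i> times twice a real part, and the factor \<i> of the form cancels the -\<i>.\<close>

lemma EH_metric_eq:
  fixes t :: real and z :: "complex^2"
  defines "u \<equiv> (cmod (z $ 1))\<^sup>2 + (cmod (z $ 2))\<^sup>2"
  defines "q \<equiv> sqrt (u\<^sup>2 + t^4)"
  assumes u: "u > 0"
  shows "EH_metric t z X Y =
     2 * (q / u) * Re (X $ 1 * cnj (Y $ 1) + X $ 2 * cnj (Y $ 2))
   - 2 * (t^4 / (q * u\<^sup>2)) * Re ((X $ 1 * cnj (z $ 1) + X $ 2 * cnj (z $ 2))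
          * cnj (Y $ 1 * cnj (z $ 1) + Y $ 2 * cnj (z $ 2)))"
proof -
  let ?q = "\<lambda>u. sqrt (u\<^sup>2 + t^4)"
  have uz: "sqnorm y = (cmod (y $ 1))\<^sup>2 + (cmod (y $ 2))\<^sup>2" for y :: "complex^2"
    by (simp add: sqnorm_def sum_2)
  define W where "W = (\<lambda>X :: complex^2. \<Sum>j\<in>UNIV. X $ j * cnj (z $ j))"
  have W: "W (\<i> *s Y) = \<i> * W Y" for Y
    by (simp add: W_def sum_distrib_left mult.assoc)
  have pot: "complex_of_real (EH_potential t y) =
      complex_of_real (?q (sqnorm y) + t\<^sup>2 * ln (sqnorm y / (?q (sqnorm y) + t\<^sup>2)))" for y
    by (simp add: EH_potential_def Let_def uz)
  have "sqnorm z = u" by (simp add: u_def uz)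
  with u have "sqnorm z > 0" by simp
  from i_ddbar_radial[where f="\<lambda>y. complex_of_real (EH_potential t y)",
    OF this pot EH_profile_deriv EH_profile_deriv2[OF this], of X "\<i> *s Y"]
  have "EH_form t z X (\<i> *s Y) = \<i> *
     (complex_of_real (- (t^4 / (q * u\<^sup>2))) * (W X * cnj (W (\<i> *s Y)) - W (\<i> *s Y) * cnj (W X))
     + complex_of_real (q / u) * (\<Sum>j\<in>UNIV. X $ j * cnj ((\<i> *s Y) $ j) - (\<i> *s Y) $ j * cnj (X $ j)))"
    by (simp only: EH_form_def W_def q_def \<open>sqnorm z = u\<close>)
  moreover have "Re (\<i> * (complex_of_real (- v) * (w * cnj (\<i> * w') - (\<i> * w') * cnj w)
       + complex_of_real c * (\<Sum>j\<in>UNIV. X $ j * cnj ((\<i> *s Y) $ j) - (\<i> *s Y) $ j * cnj (X $ j))))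
     = 2 * c * Re (X $ 1 * cnj (Y $ 1) + X $ 2 * cnj (Y $ 2)) - 2 * v * Re (w * cnj w')" for v c w w'
    by (simp add: sum_2 algebra_simps)
  ultimately show ?thesis
    by (simp only: EH_metric_def W) (simp add: W_def sum_2)
qed

section \<open>The induced metric in coordinates\<close>

lemma bounded_linear_axis: "bounded_linear (axis k :: 'a::euclidean_space \<Rightarrow> 'a^'n::finite)"
  unfolding linear_conv_bounded_linear[symmetric]
  by (rule linearI) (auto simp: axis_def vec_eq_iff)

lemma Psi_eq_axis:
  "Psi \<Gamma> x = axis 1 (complex_of_real (x $ 2) * cis (x $ 3) * \<Gamma> (x $ 1))
     + axis 2 (complex_of_real (x $ 2) * cis (x $ 3))"
  by (simp add: Psi_def vec_eq_iff forall_2 axis_def)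

lemma cis_line_deriv:
  "((\<lambda>\<tau>. cis (c + \<tau>)) has_vector_derivative \<i> * cis c) (at 0)"
  unfolding has_vector_derivative_def by (auto intro!: derivative_eq_intros)

lemma dir_deriv_Psi:
  fixes x :: "real^3"
  assumes "(\<Gamma> has_vector_derivative \<Gamma>') (at (x $ 1))"
  defines "e \<equiv> cis (x $ 3)"
  shows "dir_deriv (Psi \<Gamma>) x (axis 1 1) = axis 1 (complex_of_real (x $ 2) * e * \<Gamma>')"
    and "dir_deriv (Psi \<Gamma>) x (axis 2 1) = axis 1 (e * \<Gamma> (x $ 1)) + axis 2 e"
    and "dir_deriv (Psi \<Gamma>) x (axis 3 1) = axis 1 (\<i> * complex_of_real (x $ 2) * e * \<Gamma> (x $ 1))
           + axis 2 (\<i> * complex_of_real (x $ 2) * e)"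
proof -
  note ax = bounded_linear.has_vector_derivative[OF bounded_linear_axis]
  have D: "dir_deriv (Psi \<Gamma>) x v = axis 1 p' + axis 2 q'"
    if "((\<lambda>\<tau>. complex_of_real ((x + \<tau> *\<^sub>R v) $ 2) * cis ((x + \<tau> *\<^sub>R v) $ 3) * \<Gamma> ((x + \<tau> *\<^sub>R v) $ 1))
         has_vector_derivative p') (at 0)"
      "((\<lambda>\<tau>. complex_of_real ((x + \<tau> *\<^sub>R v) $ 2) * cis ((x + \<tau> *\<^sub>R v) $ 3))
         has_vector_derivative q') (at 0)" for v p' q'
    unfolding Psi_eq_axis by (intro dir_deriv_eqI has_vector_derivative_add ax that)
  have "((\<lambda>\<tau>. \<Gamma> (x $ 1 + \<tau>)) has_vector_derivative \<Gamma>') (at 0)"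
  proof -
    have "((\<lambda>\<tau>. x $ 1 + \<tau>) has_vector_derivative 1) (at 0)"
      unfolding has_real_derivative_iff_has_vector_derivative[symmetric]
      by (auto intro!: derivative_eq_intros)
    from vector_diff_chain_at[OF this, of \<Gamma> \<Gamma>'] show ?thesis
      using assms(1) by (simp add: o_def)
  qed
  then show "dir_deriv (Psi \<Gamma>) x (axis 1 1) = axis 1 (complex_of_real (x $ 2) * e * \<Gamma>')"
    by (subst D[where p' = "complex_of_real (x $ 2) * e * \<Gamma>'" and q' = 0])
      (auto simp: axis_def e_def vec_eq_iff intro!: has_vector_derivative_mult_right)
  have r: "((\<lambda>\<tau>. complex_of_real (x $ 2 + \<tau>)) has_vector_derivative 1) (at 0)"
    using has_vector_derivative_of_real[of "\<lambda>\<tau>. x $ 2 + \<tau>" 1 "at 0"]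
    by (auto simp: has_real_derivative_iff_has_vector_derivative[symmetric] intro!: derivative_eq_intros)
  show "dir_deriv (Psi \<Gamma>) x (axis 2 1) = axis 1 (e * \<Gamma> (x $ 1)) + axis 2 e"
    using has_vector_derivative_mult_left[OF r, of e]
      has_vector_derivative_mult_left[OF r, of "e * \<Gamma> (x $ 1)"]
    by (intro D) (simp_all add: axis_def e_def mult.assoc)
  show "dir_deriv (Psi \<Gamma>) x (axis 3 1) = axis 1 (\<i> * complex_of_real (x $ 2) * e * \<Gamma> (x $ 1))
           + axis 2 (\<i> * complex_of_real (x $ 2) * e)"
    using has_vector_derivative_mult_right[OF cis_line_deriv, of "complex_of_real (x $ 2)" "x $ 3"]
      has_vector_derivative_mult_right[OF cis_line_deriv, of "complex_of_real (x $ 2) * \<Gamma> (x $ 1)" "x $ 3"]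
    by (intro D) (simp_all add: axis_def e_def mult_ac)
qed

text \<open>Here a + ib is \<Gamma>' times the conjugate of \<Gamma>. The root \<open>q\<close> is a
  separate argument, so that the entries are rational in their arguments.\<close>

definition slice_metric :: "real \<Rightarrow> real \<Rightarrow> real \<Rightarrow> real \<Rightarrow> real \<Rightarrow> real^3^3"
  where "slice_metric q A a b \<rho> =
    vector [vector [2 * q / A\<^sup>2 + 2 * \<rho>^4 * (a\<^sup>2 + b\<^sup>2) / q, 2 * \<rho>^3 * A * a / q, 2 * \<rho>^4 * A * b / q],
            vector [2 * \<rho>^3 * A * a / q, 2 * \<rho>\<^sup>2 * A\<^sup>2 / q, 0],
            vector [2 * \<rho>^4 * A * b / q, 0, 2 * \<rho>^4 * A\<^sup>2 / q]]"

lemma induced_metric_eq: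
  fixes x :: "real^3"
  assumes \<Gamma>: "(\<Gamma> has_vector_derivative \<Gamma>') (at (x $ 1))" and unit: "cmod \<Gamma>' = 1"
    and pos: "x $ 2 > 0"
  defines "A \<equiv> (cmod (\<Gamma> (x $ 1)))\<^sup>2 + 1" and "c \<equiv> \<Gamma>' * cnj (\<Gamma> (x $ 1))"
  shows "induced_metric t \<Gamma> x =
     slice_metric (sqrt ((x $ 2)^4 * A\<^sup>2 + t^4)) A (Re c) (Im c) (x $ 2)"
proof -
  define \<rho> G a b where "\<rho> = x $ 2" and "G = \<Gamma> (x $ 1)" and "a = Re c" and "b = Im c"
  define e u where "e = cis (x $ 3)" and "u = \<rho>\<^sup>2 * A"
  define q where "q = sqrt (u\<^sup>2 + t^4)"
  have A: "A > 0" unfolding A_def by (simp add: add_nonneg_pos)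
  have u: "u > 0" using pos A by (simp add: u_def \<rho>_def)
  have q2: "q\<^sup>2 = u\<^sup>2 + t^4" and q: "q > 0"
    using u by (auto simp: q_def add_pos_nonneg)
  have ee: "e * cnj e = 1" by (simp add: e_def cis_cnj cis_mult)
  have GG: "G * cnj G = complex_of_real (A - 1)"
    by (simp add: A_def G_def complex_norm_square[symmetric] flip: of_real_power)
  have \<Gamma>\<Gamma>: "\<Gamma>' * cnj \<Gamma>' = 1"
    using unit by (metis complex_norm_square of_real_1 one_power2)
  have c: "\<Gamma>' * cnj G = c" by (simp add: c_def G_def)
  have cc: "c * cnj c = complex_of_real (A - 1)"
    using GG \<Gamma>\<Gamma> by (simp add: c_def G_def mult_ac)
  have ab: "a\<^sup>2 + b\<^sup>2 = A - 1"
    using cc unfolding complex_norm_square[symmetric] of_real_eq_iff a_def b_def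
    by (simp add: cmod_power2)
  have z: "Psi \<Gamma> x $ 1 = \<rho> * e * G" "Psi \<Gamma> x $ 2 = \<rho> * e"
    by (simp_all add: Psi_def \<rho>_def e_def G_def)
  have uz: "(cmod (Psi \<Gamma> x $ 1))\<^sup>2 + (cmod (Psi \<Gamma> x $ 2))\<^sup>2 = u"
    unfolding z by (simp add: norm_mult e_def u_def A_def G_def power_mult_distrib algebra_simps)
  define X where "X = (\<lambda>i::3. dir_deriv (Psi \<Gamma>) x (axis i 1))"
  have X: "X 1 $ 1 = \<rho> * e * \<Gamma>'" "X 1 $ 2 = 0" "X 2 $ 1 = e * G" "X 2 $ 2 = e"
    "X 3 $ 1 = \<i> * \<rho> * e * G" "X 3 $ 2 = \<i> * \<rho> * e"
    unfolding X_def dir_deriv_Psi[where \<Gamma>'=\<Gamma>', OF \<Gamma>] by (simp_all add: axis_def \<rho>_def e_def G_def)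
  \<comment> \<open>For \<open>algebra\<close> the conjugates are independent unknowns, tied to the
    originals only by \<open>ee\<close>, \<open>c\<close>, \<open>GG\<close> and, for
    \<open>p\<close>, also \<open>\<Gamma>\<Gamma>\<close>.\<close>
  have w: "X 1 $ 1 * cnj (Psi \<Gamma> x $ 1) + X 1 $ 2 * cnj (Psi \<Gamma> x $ 2) = \<rho>\<^sup>2 * c"
    "X 2 $ 1 * cnj (Psi \<Gamma> x $ 1) + X 2 $ 2 * cnj (Psi \<Gamma> x $ 2) = \<rho> * A"
    "X 3 $ 1 * cnj (Psi \<Gamma> x $ 1) + X 3 $ 2 * cnj (Psi \<Gamma> x $ 2) = \<i> * \<rho>\<^sup>2 * A"
    using ee c GG unfolding X z complex_cnj_mult complex_cnj_complex_of_real of_real_mult of_real_power of_real_diff of_real_1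
    by algebra+
  have p: "X 1 $ 1 * cnj (X 1 $ 1) + X 1 $ 2 * cnj (X 1 $ 2) = \<rho>\<^sup>2"
    "X 1 $ 1 * cnj (X 2 $ 1) + X 1 $ 2 * cnj (X 2 $ 2) = \<rho> * c"
    "X 1 $ 1 * cnj (X 3 $ 1) + X 1 $ 2 * cnj (X 3 $ 2) = - \<i> * \<rho>\<^sup>2 * c"
    "X 2 $ 1 * cnj (X 2 $ 1) + X 2 $ 2 * cnj (X 2 $ 2) = A"
    "X 2 $ 1 * cnj (X 3 $ 1) + X 2 $ 2 * cnj (X 3 $ 2) = - \<i> * \<rho> * A"
    "X 3 $ 1 * cnj (X 3 $ 1) + X 3 $ 2 * cnj (X 3 $ 2) = \<rho>\<^sup>2 * A"
    using ee c GG \<Gamma>\<Gamma> i_squared unfolding X z complex_cnj_mult complex_cnj_complex_of_real of_real_mult of_real_power of_real_diff of_real_1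
      complex_cnj_i complex_cnj_zero
    by algebra+
  have m: "EH_metric t (Psi \<Gamma> x) (X i) (X j) =
     2 * (q / u) * Re (X i $ 1 * cnj (X j $ 1) + X i $ 2 * cnj (X j $ 2))
   - 2 * (t^4 / (q * u\<^sup>2)) * Re ((X i $ 1 * cnj (Psi \<Gamma> x $ 1) + X i $ 2 * cnj (Psi \<Gamma> x $ 2))
          * cnj (X j $ 1 * cnj (Psi \<Gamma> x $ 1) + X j $ 2 * cnj (Psi \<Gamma> x $ 2)))" for i j
    using EH_metric_eq[of "Psi \<Gamma> x" t "X i" "X j"] u unfolding uz q_def by simp
  have sym: "EH_metric t (Psi \<Gamma> x) (X i) (X j) = EH_metric t (Psi \<Gamma> x) (X j) (X i)" for i j
    unfolding m by (simp add: algebra_simps)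
  \<comment> \<open>This covers every pair containing \<open>X 2\<close> or \<open>X 3\<close>:
    these are z/\<rho> and \<i> z, and for a vector on the complex line of z the product of the
    Hermitian products with z is u times the Hermitian product of the pair.\<close>
  have red: "2 * (q / u) * E' - 2 * (t^4 / (q * u\<^sup>2)) * W = 2 * u * E / q" if "E' = E" "W = u * E" for E E' W
  proof -
    have "2 * (q / u) * E' - 2 * (t^4 / (q * u\<^sup>2)) * W = 2 * E * (q\<^sup>2 - t^4) / (q * u)"
      using u q that by (simp add: field_simps power2_eq_square)
    also have "q\<^sup>2 - t^4 = u\<^sup>2" using q2 by simp
    finally show ?thesis using u by (simp add: power2_eq_square)
  qed
  \<comment> \<open>Only \<open>X 1\<close> leaves the line of z: the second product is \<rho>^4 (A
    - 1) instead of u \<rho>^2 = \<rho>^4 A, and the deficit produces the term 2q/A^2.\<close>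
  have "EH_metric t (Psi \<Gamma> x) (X 1) (X 1) = 2 * q / A\<^sup>2 + 2 * \<rho>^4 * (a\<^sup>2 + b\<^sup>2) / q"
  proof -
    have "EH_metric t (Psi \<Gamma> x) (X 1) (X 1) = 2 * (q / u) * \<rho>\<^sup>2 - 2 * (t^4 / (q * u\<^sup>2)) * (\<rho>^4 * (A - 1))"
      unfolding m p w ab[symmetric]
      by (simp add: a_def b_def power2_eq_square power4_eq_xxxx algebra_simps)
    also have "\<dots> = 2 * (q\<^sup>2 * A - t^4 * (A - 1)) / (q * A\<^sup>2)"
      using pos A q unfolding u_def \<rho>_def[symmetric]
      by (simp add: field_simps power2_eq_square power4_eq_xxxx)
    also have "q\<^sup>2 * A - t^4 * (A - 1) = q\<^sup>2 + u\<^sup>2 * (A - 1)" unfolding q2 by (simp add: algebra_simps)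
    also have "2 * (q\<^sup>2 + u\<^sup>2 * (A - 1)) / (q * A\<^sup>2) = 2 * q / A\<^sup>2 + 2 * \<rho>^4 * (A - 1) / q"
      using A q by (simp add: u_def field_simps power2_eq_square power4_eq_xxxx)
    finally show ?thesis by (simp add: ab)
  qed
  moreover have "EH_metric t (Psi \<Gamma> x) (X 1) (X 2) = 2 * \<rho>^3 * A * a / q"
    unfolding m p w by (subst red[where E="\<rho> * a"]) (simp_all add: u_def a_def power2_eq_square power3_eq_cube)
  moreover have "EH_metric t (Psi \<Gamma> x) (X 1) (X 3) = 2 * \<rho>^4 * A * b / q"
    unfolding m p w by (subst red[where E="\<rho>\<^sup>2 * b"]) (simp_all add: u_def b_def power2_eq_square power4_eq_xxxx)
  moreover have "EH_metric t (Psi \<Gamma> x) (X 2) (X 2) = 2 * \<rho>\<^sup>2 * A\<^sup>2 / q"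
    unfolding m p w by (subst red[where E="A"]) (simp_all add: u_def power2_eq_square)
  moreover have "EH_metric t (Psi \<Gamma> x) (X 2) (X 3) = 0"
    unfolding m p w by (subst red[where E="0"]) (simp_all)
  moreover have "EH_metric t (Psi \<Gamma> x) (X 3) (X 3) = 2 * \<rho>^4 * A\<^sup>2 / q"
    unfolding m p w by (subst red[where E="\<rho>\<^sup>2 * A"]) (simp_all add: u_def power2_eq_square power4_eq_xxxx)
  moreover have "q = sqrt (\<rho>^4 * A\<^sup>2 + t^4)"
    by (simp add: q_def u_def power_mult_distrib flip: power_mult)
  moreover have "induced_metric t \<Gamma> x = (\<chi> i j. EH_metric t (Psi \<Gamma> x) (X i) (X j))"
    by (simp add: induced_metric_def X_def)
  ultimately show ?thesis
    unfolding slice_metric_def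
    using sym[of 2 1] sym[of 3 1] sym[of 3 2]
    by (simp add: vec_eq_iff forall_3 \<rho>_def a_def b_def)
qed

section \<open>Christoffel symbols and Ricci tensor in closed form\<close>

lemma matrix_inv_left:
  fixes G :: "real^'n^'n"
  assumes "invertible G"
  shows "matrix_inv G ** G = mat 1"
  using someI_ex[OF assms[unfolded invertible_def]] by (simp add: matrix_inv_def)

text \<open>Allows Christoffel symbols to be verified in lowered form, without ever computing the
  inverse metric.\<close>

lemma matrix_inv_sandwich:
  fixes G :: "real^'n^'n"
  assumes "invertible G"
  shows "(\<Sum>l\<in>UNIV. matrix_inv G $ c $ l * (\<Sum>k\<in>UNIV. G $ l $ k * v k)) = v c"
proof -
  have "matrix_inv G *v (G *v (\<chi> k. v k)) = (\<chi> k. v k)"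
    using matrix_inv_left[OF assms] by (simp add: matrix_vector_mul_assoc)
  then have "(matrix_inv G *v (G *v (\<chi> k. v k))) $ c = v c" by simp
  then show ?thesis by (simp add: matrix_vector_mult_def)
qed

lemma dir_deriv_slice:
  fixes F :: "real^3 \<Rightarrow> real"
  assumes U: "open U" "x \<in> U" "\<And>y. y \<in> U \<Longrightarrow> F y = f (y $ 1) (y $ 2)"
  shows "((\<lambda>s. f s (x $ 2)) has_real_derivative D1) (at (x $ 1)) \<Longrightarrow> dir_deriv F x (axis 1 1) = D1"
    and "((\<lambda>\<rho>. f (x $ 1) \<rho>) has_real_derivative D2) (at (x $ 2)) \<Longrightarrow> dir_deriv F x (axis 2 1) = D2"
    and "dir_deriv F x (axis 3 1) = 0"
  by (rule dir_deriv_axis[OF U]; simp add: axis_def)+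

lemma slice_metric_nth:
  "slice_metric q A a b \<rho> $ 1 $ 1 = 2 * q / A\<^sup>2 + 2 * \<rho>^4 * (a\<^sup>2 + b\<^sup>2) / q"
  "slice_metric q A a b \<rho> $ 1 $ 2 = 2 * \<rho>^3 * A * a / q"
  "slice_metric q A a b \<rho> $ 1 $ 3 = 2 * \<rho>^4 * A * b / q"
  "slice_metric q A a b \<rho> $ 2 $ 1 = 2 * \<rho>^3 * A * a / q"
  "slice_metric q A a b \<rho> $ 2 $ 2 = 2 * \<rho>\<^sup>2 * A\<^sup>2 / q"
  "slice_metric q A a b \<rho> $ 2 $ 3 = 0"
  "slice_metric q A a b \<rho> $ 3 $ 1 = 2 * \<rho>^4 * A * b / q"
  "slice_metric q A a b \<rho> $ 3 $ 2 = 0"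
  "slice_metric q A a b \<rho> $ 3 $ 3 = 2 * \<rho>^4 * A\<^sup>2 / q"
  by (simp_all add: slice_metric_def)

text \<open>The diagonal coefficients multiply to 2u^2/q, and the coframe (\<alpha>, du, \<beta>)
  has Jacobian 2\<rho>, which enters squared.\<close>

lemma det_slice_metric:
  assumes "q > 0" "A > 0"
  shows "det (slice_metric q A a b \<rho>) = 8 * \<rho>^6 * A\<^sup>2 / q"
  using assms by (simp add: det_3 slice_metric_nth divide_simps) algebra

text \<open>
  With \<open>A = |\<Gamma>|\<^sup>2 + 1\<close>, \<open>\<Gamma>' \<Gamma>\<^sup>- = a + \<i> b\<close>, curvature \<open>k\<close> (that is, \<open>\<Gamma>'' = \<i> k \<Gamma>'\<close>), \<open>u = \<rho>\<^sup>2 A\<close> and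
  \<open>q\<^sup>2 = u\<^sup>2 + t\<^sup>4\<close>, the metric is
  \<open>2 q \<alpha>\<^sup>2 + du\<^sup>2 / (2 q) + (2 u\<^sup>2 / q) \<beta>\<^sup>2\<close> with the closed forms \<open>\<alpha> = ds / A\<close> and \<open>\<beta> = d\<phi> + (b / A) ds\<close>.
  The Christoffel symbols below are those of this diagonal metric, transformed back to \<open>(s, \<rho>, \<phi>)\<close>;
  they are rational because \<open>q\<close> enters only through \<open>m = u / (2 q\<^sup>2)\<close>. The suffixes \<open>_ds\<close> and \<open>_dr\<close>
  denote partial derivatives in \<open>s\<close> and \<open>\<rho>\<close>; the entries \<open>(1, 1)\<close> of \<open>slice_chr_ds\<close>, which
  could involve \<open>k'\<close>, cancel in the curvature and are set to the junk value \<open>0\<close>.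
\<close>

definition slice_metric_ds :: "real \<Rightarrow> real \<Rightarrow> real \<Rightarrow> real \<Rightarrow> real \<Rightarrow> real \<Rightarrow> real^3^3"
  where "slice_metric_ds q A a b k \<rho> = (let q' = 2 * a * \<rho>^4 * A / q in
    vector [vector [2 * q' / A\<^sup>2 - 8 * q * a / A^3 + (4 * \<rho>^4 * a * q - 2 * \<rho>^4 * (a\<^sup>2 + b\<^sup>2) * q') / q\<^sup>2,
        2 * \<rho>^3 * ((2 * a * a + A * (1 - k * b)) * q - A * a * q') / q\<^sup>2,
        2 * \<rho>^4 * ((2 * a * b + A * k * a) * q - A * b * q') / q\<^sup>2],
      vector [2 * \<rho>^3 * ((2 * a * a + A * (1 - k * b)) * q - A * a * q') / q\<^sup>2,
        2 * \<rho>\<^sup>2 * (4 * A * a * q - A\<^sup>2 * q') / q\<^sup>2,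
        0],
      vector [2 * \<rho>^4 * ((2 * a * b + A * k * a) * q - A * b * q') / q\<^sup>2,
        0,
        2 * \<rho>^4 * (4 * A * a * q - A\<^sup>2 * q') / q\<^sup>2]])"

definition slice_metric_dr :: "real \<Rightarrow> real \<Rightarrow> real \<Rightarrow> real \<Rightarrow> real \<Rightarrow> real^3^3"
  where "slice_metric_dr q A a b \<rho> = (let q' = 2 * \<rho>^3 * A\<^sup>2 / q in
    vector [vector [2 * q' / A\<^sup>2 + 2 * (a\<^sup>2 + b\<^sup>2) * (4 * \<rho>^3 * q - \<rho>^4 * q') / q\<^sup>2,
        2 * A * a * (3 * \<rho>\<^sup>2 * q - \<rho>^3 * q') / q\<^sup>2,
        2 * A * b * (4 * \<rho>^3 * q - \<rho>^4 * q') / q\<^sup>2],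
      vector [2 * A * a * (3 * \<rho>\<^sup>2 * q - \<rho>^3 * q') / q\<^sup>2,
        2 * A\<^sup>2 * (2 * \<rho> * q - \<rho>\<^sup>2 * q') / q\<^sup>2,
        0],
      vector [2 * A * b * (4 * \<rho>^3 * q - \<rho>^4 * q') / q\<^sup>2,
        0,
        2 * A\<^sup>2 * (4 * \<rho>^3 * q - \<rho>^4 * q') / q\<^sup>2]])"

definition slice_chr :: "real \<Rightarrow> real \<Rightarrow> real \<Rightarrow> real \<Rightarrow> real \<Rightarrow> real \<Rightarrow> real^3^3^3"
  where "slice_chr m A a b k \<rho> = vector [
    vector [vector [4 * m * a * \<rho>\<^sup>2 - 2 * a / A, 2 * \<rho> * A * m, 0],
      vector [2 * \<rho> * A * m, 0, 0],
      vector [0, 0, 0]],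
    vector [vector [\<rho> / A * ((1 - k * b) - 1 / A - 2 * b\<^sup>2 / A + 2 * a\<^sup>2 / A + m * \<rho>\<^sup>2 * (2 * b\<^sup>2 - 6 * a\<^sup>2)),
        2 * a / A - 4 * m * a * \<rho>\<^sup>2,
        2 * \<rho>^3 * b * m - 2 * \<rho> * b / A],
      vector [2 * a / A - 4 * m * a * \<rho>\<^sup>2, 1 / \<rho> - 2 * m * \<rho> * A, 0],
      vector [2 * \<rho>^3 * b * m - 2 * \<rho> * b / A, 0, 2 * \<rho>^3 * A * m - 2 * \<rho>]],
    vector [vector [k * a / A + 4 * a * b / A\<^sup>2 - 8 * a * b * \<rho>\<^sup>2 * m / A,
        2 * b / (\<rho> * A) - 4 * \<rho> * b * m,
        2 * a / A - 2 * a * \<rho>\<^sup>2 * m],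
      vector [2 * b / (\<rho> * A) - 4 * \<rho> * b * m, 0, 2 / \<rho> - 2 * \<rho> * A * m],
      vector [2 * a / A - 2 * a * \<rho>\<^sup>2 * m, 2 / \<rho> - 2 * \<rho> * A * m, 0]]]"

definition slice_chr_ds :: "real \<Rightarrow> real \<Rightarrow> real \<Rightarrow> real \<Rightarrow> real \<Rightarrow> real \<Rightarrow> real^3^3^3"
  where "slice_chr_ds m A a b k \<rho> = (let m' = 2 * a * m / A - 8 * a * \<rho>\<^sup>2 * m\<^sup>2 in vector [
    vector [vector [0, 2 * \<rho> * (2 * a * m + A * m'), 0],
      vector [2 * \<rho> * (2 * a * m + A * m'), 0, 0],
      vector [0, 0, 0]],
    vector [vector [0,
        2 * (1 - k * b) / A - 4 * a\<^sup>2 / A\<^sup>2 - 4 * \<rho>\<^sup>2 * (m' * a + m * (1 - k * b)),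
        2 * \<rho>^3 * (k * a * m + b * m') - 2 * \<rho> * (k * a / A - 2 * a * b / A\<^sup>2)],
      vector [2 * (1 - k * b) / A - 4 * a\<^sup>2 / A\<^sup>2 - 4 * \<rho>\<^sup>2 * (m' * a + m * (1 - k * b)),
        - 2 * \<rho> * (2 * a * m + A * m'),
        0],
      vector [2 * \<rho>^3 * (k * a * m + b * m') - 2 * \<rho> * (k * a / A - 2 * a * b / A\<^sup>2),
        0,
        2 * \<rho>^3 * (2 * a * m + A * m')]],
    vector [vector [0,
        2 / \<rho> * (k * a / A - 2 * a * b / A\<^sup>2) - 4 * \<rho> * (k * a * m + b * m'),
        2 * (1 - k * b) / A - 4 * a\<^sup>2 / A\<^sup>2 - 2 * \<rho>\<^sup>2 * (m' * a + m * (1 - k * b))],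
      vector [2 / \<rho> * (k * a / A - 2 * a * b / A\<^sup>2) - 4 * \<rho> * (k * a * m + b * m'),
        0,
        - 2 * \<rho> * (2 * a * m + A * m')],
      vector [2 * (1 - k * b) / A - 4 * a\<^sup>2 / A\<^sup>2 - 2 * \<rho>\<^sup>2 * (m' * a + m * (1 - k * b)),
        - 2 * \<rho> * (2 * a * m + A * m'),
        0]]])"

definition slice_chr_dr :: "real \<Rightarrow> real \<Rightarrow> real \<Rightarrow> real \<Rightarrow> real \<Rightarrow> real \<Rightarrow> real^3^3^3"
  where "slice_chr_dr m A a b k \<rho> = (let m' = 2 * m / \<rho> - 8 * \<rho> * A * m\<^sup>2 in vector [
    vector [vector [4 * a * (2 * \<rho> * m + \<rho>\<^sup>2 * m'), 2 * A * (m + \<rho> * m'), 0],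
      vector [2 * A * (m + \<rho> * m'), 0, 0],
      vector [0, 0, 0]],
    vector [vector [((1 - k * b) - 1 / A - 2 * b\<^sup>2 / A + 2 * a\<^sup>2 / A) / A + (2 * b\<^sup>2 - 6 * a\<^sup>2) / A * (3 * \<rho>\<^sup>2 * m + \<rho>^3 * m'),
        - 4 * a * (2 * \<rho> * m + \<rho>\<^sup>2 * m'),
        2 * b * (3 * \<rho>\<^sup>2 * m + \<rho>^3 * m') - 2 * b / A],
      vector [- 4 * a * (2 * \<rho> * m + \<rho>\<^sup>2 * m'),
        - 1 / \<rho>\<^sup>2 - 2 * A * (m + \<rho> * m'),
        0],
      vector [2 * b * (3 * \<rho>\<^sup>2 * m + \<rho>^3 * m') - 2 * b / A,
        0,
        2 * A * (3 * \<rho>\<^sup>2 * m + \<rho>^3 * m') - 2]],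
    vector [vector [- 8 * a * b / A * (2 * \<rho> * m + \<rho>\<^sup>2 * m'),
        - 2 * b / (\<rho>\<^sup>2 * A) - 4 * b * (m + \<rho> * m'),
        - 2 * a * (2 * \<rho> * m + \<rho>\<^sup>2 * m')],
      vector [- 2 * b / (\<rho>\<^sup>2 * A) - 4 * b * (m + \<rho> * m'),
        0,
        - 2 / \<rho>\<^sup>2 - 2 * A * (m + \<rho> * m')],
      vector [- 2 * a * (2 * \<rho> * m + \<rho>\<^sup>2 * m'),
        - 2 / \<rho>\<^sup>2 - 2 * A * (m + \<rho> * m'),
        0]]])"

text \<open>Cuts nine index pairs down to six; the symmetry itself is always the seventh
  goal.\<close>

lemma exhaust_3_sym:
  fixes P :: "3 \<Rightarrow> 3 \<Rightarrow> bool"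
  assumes "P 1 1" "P 1 2" "P 1 3" "P 2 2" "P 2 3" "P 3 3" "\<And>i j. P i j \<Longrightarrow> P j i"
  shows "P i j"
  using exhaust_3[of i] exhaust_3[of j] assms by auto

lemma slice_chr_sym: "slice_chr m A a b k \<rho> $ c $ i $ j = slice_chr m A a b k \<rho> $ c $ j $ i"
  by (rule exhaust_3_sym) (use exhaust_3[of c] in \<open>auto simp: slice_chr_def\<close>)

lemma slice_metric_sym: "slice_metric q A a b \<rho> $ i $ j = slice_metric q A a b \<rho> $ j $ i"
  by (rule exhaust_3_sym; simp add: slice_metric_nth)

lemma slice_chr_ds_sym: "slice_chr_ds m A a b k \<rho> $ c $ i $ j = slice_chr_ds m A a b k \<rho> $ c $ j $ i"
  by (rule exhaust_3_sym) (use exhaust_3[of c] in \<open>auto simp: slice_chr_ds_def Let_def\<close>)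

lemma slice_chr_dr_sym: "slice_chr_dr m A a b k \<rho> $ c $ i $ j = slice_chr_dr m A a b k \<rho> $ c $ j $ i"
  by (rule exhaust_3_sym) (use exhaust_3[of c] in \<open>auto simp: slice_chr_dr_def Let_def\<close>)

lemma slice_metric_ds_sym: "slice_metric_ds q A a b k \<rho> $ i $ j = slice_metric_ds q A a b k \<rho> $ j $ i"
  by (rule exhaust_3_sym; simp add: slice_metric_ds_def Let_def)

lemma slice_metric_dr_sym: "slice_metric_dr q A a b \<rho> $ i $ j = slice_metric_dr q A a b \<rho> $ j $ i"
  by (rule exhaust_3_sym; simp add: slice_metric_dr_def Let_def)

text \<open>The Koszul formula with the upper index lowered by the metric. The third block of
  \<open>d\<close> is 0 because nothing depends on \<phi>.\<close>

lemma slice_compatible: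
  fixes q A a b k m \<rho> :: real
  assumes "A > 0" "\<rho> > 0" "q > 0" and ab: "a\<^sup>2 + b\<^sup>2 = A - 1"
    and m: "m = \<rho>\<^sup>2 * A / (2 * q\<^sup>2)"
  defines "d \<equiv> vector [slice_metric_ds q A a b k \<rho>, slice_metric_dr q A a b \<rho>, 0] :: real^3^3^3"
  shows "(\<Sum>c\<in>UNIV. slice_metric q A a b \<rho> $ l $ c * slice_chr m A a b k \<rho> $ c $ i $ j)
      = (d $ i $ j $ l + d $ j $ i $ l - d $ l $ i $ j) / 2"
proof -
  have A: "A = a\<^sup>2 + b\<^sup>2 + 1" using ab by simp
  have sym: "d $ l $ i $ j = d $ l $ j $ i" for l i j
    using exhaust_3[of l] slice_metric_ds_sym slice_metric_dr_sym by (auto simp: d_def)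
  \<comment> \<open>Symmetry holds in i and j only, so \<open>l\<close> is quantified inside and
    expanded separately in each of the six cases.\<close>
  have *: "\<forall>l. (\<Sum>c\<in>UNIV. slice_metric q A a b \<rho> $ l $ c * slice_chr m A a b k \<rho> $ c $ i $ j)
      = (d $ i $ j $ l + d $ j $ i $ l - d $ l $ i $ j) / 2"
  proof (rule exhaust_3_sym[of _ i j], goal_cases)
    case (7 i j)
    then show ?case by (simp add: sym[of _ j i] slice_chr_sym[of _ _ _ _ _ _ _ j i] add.commute)
  qed ((use assms(1-3) in \<open>simp only: forall_3; intro conjI; simp add: m d_def slice_metric_nth
      slice_metric_ds_def slice_metric_dr_def slice_chr_def sum_3 Let_def divide_simps;
      ((simp add: A)?; algebra)?\<close>)+)
  then show ?thesis by blast
qed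

text \<open>\<open>R1\<close>, \<open>R2\<close>, \<open>R3\<close> are the coefficients of \<open>\<alpha>\<^sup>2\<close>, \<open>du\<^sup>2\<close>, \<open>\<beta>\<^sup>2\<close> in the Ricci tensor.\<close>

definition slice_ricci :: "real \<Rightarrow> real \<Rightarrow> real \<Rightarrow> real \<Rightarrow> real \<Rightarrow> real^3^3"
  where "slice_ricci m A a b \<rho> =
   (let R1 = (6 * \<rho>\<^sup>2 * A * m - 4) / A\<^sup>2; R2 = m / (\<rho>\<^sup>2 * A) - 2 * m\<^sup>2;
        R3 = 4 * \<rho>\<^sup>2 * A * m - 12 * \<rho>^4 * A\<^sup>2 * m\<^sup>2
    in vector [vector [R1 + 4 * a\<^sup>2 * \<rho>^4 * R2 + b\<^sup>2 / A\<^sup>2 * R3, 4 * a * A * \<rho>^3 * R2, b / A * R3],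
               vector [4 * a * A * \<rho>^3 * R2, 4 * A\<^sup>2 * \<rho>\<^sup>2 * R2, 0],
               vector [b / A * R3, 0, R3]])"

text \<open>A rational identity in which k and m are free: the derivative of m is already built into
  the tables. The \<open>if\<close> masks exactly the terms that would read a junk entry of
  \<open>slice_chr_ds\<close>.\<close>

lemma slice_ricci_eq:
  fixes A a b k m \<rho> :: real
  assumes "A > 0" "\<rho> > 0" and ab: "a\<^sup>2 + b\<^sup>2 = A - 1"
  defines "C \<equiv> slice_chr m A a b k \<rho>"
    and "d \<equiv> vector [slice_chr_ds m A a b k \<rho>, slice_chr_dr m A a b k \<rho>, 0] :: real^3^3^3^3"
  shows "(\<Sum>i\<in>UNIV. (if i = j then 0 else d $ i $ i $ j $ l - d $ j $ i $ i $ l)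
       + (\<Sum>c\<in>UNIV. C $ i $ i $ c * C $ c $ j $ l - C $ i $ j $ c * C $ c $ i $ l))
     = slice_ricci m A a b \<rho> $ j $ l"
proof -
  have A: "A = a\<^sup>2 + b\<^sup>2 + 1" using ab by simp
  have "\<forall>j l. (\<Sum>i\<in>UNIV. (if i = j then 0 else d $ i $ i $ j $ l - d $ j $ i $ i $ l)
       + (\<Sum>c\<in>UNIV. C $ i $ i $ c * C $ c $ j $ l - C $ i $ j $ c * C $ c $ i $ l))
     = slice_ricci m A a b \<rho> $ j $ l"
    unfolding forall_3
  proof (intro conjI)
  qed ((use assms(1-2) in \<open>simp add: C_def d_def slice_chr_def slice_chr_ds_def slice_chr_dr_def
      slice_ricci_def sum_3 Let_def divide_simps; ((simp add: A)?; algebra)?\<close>)+)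
  then show ?thesis by blast
qed

section \<open>Metrics of the induced form\<close>

text \<open>The laws for a and b are the real and imaginary parts of c' = 1 + \<i> k c with c = a +
  \<i> b, which is what \<Gamma>'' = \<i> k \<Gamma>' and unit speed give.\<close>

locale slice =
  fixes t :: real and I :: "real set" and A a b k :: "real \<Rightarrow> real" and h :: "real^3 \<Rightarrow> real^3^3"
  assumes open_I: "open I"
    and dA: "\<And>s. s \<in> I \<Longrightarrow> (A has_real_derivative 2 * a s) (at s)"
    and da: "\<And>s. s \<in> I \<Longrightarrow> (a has_real_derivative 1 - k s * b s) (at s)"
    and db: "\<And>s. s \<in> I \<Longrightarrow> (b has_real_derivative k s * a s) (at s)"
    and ab: "\<And>s. s \<in> I \<Longrightarrow> (a s)\<^sup>2 + (b s)\<^sup>2 = A s - 1"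
    and h: "\<And>y. y $ 1 \<in> I \<Longrightarrow> y $ 2 > 0 \<Longrightarrow> h y =
      slice_metric (sqrt ((y $ 2)^4 * (A (y $ 1))\<^sup>2 + t^4)) (A (y $ 1)) (a (y $ 1)) (b (y $ 1)) (y $ 2)"
begin

definition q :: "real \<Rightarrow> real \<Rightarrow> real" where "q s \<rho> = sqrt (\<rho>^4 * (A s)\<^sup>2 + t^4)"
definition m :: "real \<Rightarrow> real \<Rightarrow> real" where "m s \<rho> = \<rho>\<^sup>2 * A s / (2 * (q s \<rho>)\<^sup>2)"
definition U :: "(real^3) set" where "U = {y. y $ 1 \<in> I \<and> y $ 2 > 0}"

lemma open_U: "open U"
proof -
  have "U = (\<lambda>y. y $ 1) -` I \<inter> {y. y $ 2 > 0}" by (auto simp: U_def)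
  then show ?thesis
    by (auto intro!: open_Int open_vimage open_I open_Collect_less continuous_intros)
qed

lemma A_pos: "s \<in> I \<Longrightarrow> A s > 0"
  using ab[of s] zero_le_power2[of "a s"] zero_le_power2[of "b s"] by linarith

lemma q_pos: assumes "s \<in> I" "\<rho> > 0" shows "q s \<rho> > 0"
proof -
  have "\<rho>^4 * (A s)\<^sup>2 > 0" using A_pos[OF assms(1)] assms(2) by simp
  then show ?thesis by (simp add: q_def add_pos_nonneg)
qed

lemma dq_s:
  assumes "s \<in> I" "\<rho> > 0"
  shows "((\<lambda>s. q s \<rho>) has_real_derivative 2 * a s * \<rho>^4 * A s / q s \<rho>) (at s)"
proof -
  have "\<rho>^4 * (A s)\<^sup>2 + t^4 > 0" using q_pos[OF assms] by (simp add: q_def)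
  note DERIV_real_sqrt[OF this]
  moreover have "((\<lambda>s. \<rho>^4 * (A s)\<^sup>2 + t^4) has_real_derivative \<rho>^4 * (2 * A s * (2 * a s))) (at s)"
    using assms by (auto intro!: derivative_eq_intros dA)
  ultimately have "((\<lambda>s. q s \<rho>) has_real_derivative inverse (q s \<rho>) / 2 * (\<rho>^4 * (2 * A s * (2 * a s)))) (at s)"
    unfolding q_def by (rule DERIV_chain2)
  moreover have "inverse w / 2 * (\<rho>^4 * (2 * A s * (2 * a s))) = 2 * a s * \<rho>^4 * A s / w" for w
    by (simp add: field_simps)
  ultimately show ?thesis by (simp only:)
qed

lemma dq_r:
  assumes "s \<in> I" "\<rho> > 0"
  shows "((\<lambda>\<rho>. q s \<rho>) has_real_derivative 2 * \<rho>^3 * (A s)\<^sup>2 / q s \<rho>) (at \<rho>)"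
proof -
  have "\<rho>^4 * (A s)\<^sup>2 + t^4 > 0" using q_pos[OF assms] by (simp add: q_def)
  note DERIV_real_sqrt[OF this]
  moreover have "((\<lambda>\<rho>. \<rho>^4 * (A s)\<^sup>2 + t^4) has_real_derivative 4 * \<rho>^3 * (A s)\<^sup>2) (at \<rho>)"
    by (auto intro!: derivative_eq_intros)
  ultimately have "((\<lambda>\<rho>. q s \<rho>) has_real_derivative inverse (q s \<rho>) / 2 * (4 * \<rho>^3 * (A s)\<^sup>2)) (at \<rho>)"
    unfolding q_def by (rule DERIV_chain2)
  moreover have "inverse w / 2 * (4 * \<rho>^3 * (A s)\<^sup>2) = 2 * \<rho>^3 * (A s)\<^sup>2 / w" for w
    by (simp add: field_simps)
  ultimately show ?thesis by (simp only:)
qed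

text \<open>As q^2 - u^2 is constant, m = u / (2 q^2) solves the Riccati equation dm/du = m/u - 4
  m^2; here the s-derivative of u is 2 a \<rho>^2. This is why the derivative tables of the symbols
  are free of q and t.\<close>

lemma dm_s:
  assumes "s \<in> I" "\<rho> > 0"
  shows "((\<lambda>s. m s \<rho>) has_real_derivative 2 * a s * m s \<rho> / A s - 8 * a s * \<rho>\<^sup>2 * (m s \<rho>)\<^sup>2) (at s)"
proof -
  note q = q_pos[OF assms] and A = A_pos[OF assms(1)]
  have "((\<lambda>s. \<rho>\<^sup>2 * A s / (2 * (q s \<rho>)\<^sup>2)) has_real_derivative
      (\<rho>\<^sup>2 * (2 * a s) * (2 * (q s \<rho>)\<^sup>2) - \<rho>\<^sup>2 * A s * (2 * (2 * q s \<rho> * (2 * a s * \<rho>^4 * A s / q s \<rho>))))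
       / ((2 * (q s \<rho>)\<^sup>2) * (2 * (q s \<rho>)\<^sup>2))) (at s)"
    using assms q by (auto intro!: derivative_eq_intros dA dq_s)
  also have "(\<rho>\<^sup>2 * (2 * a s) * (2 * (q s \<rho>)\<^sup>2) - \<rho>\<^sup>2 * A s * (2 * (2 * q s \<rho> * (2 * a s * \<rho>^4 * A s / q s \<rho>))))
       / ((2 * (q s \<rho>)\<^sup>2) * (2 * (q s \<rho>)\<^sup>2)) = 2 * a s * m s \<rho> / A s - 8 * a s * \<rho>\<^sup>2 * (m s \<rho>)\<^sup>2"
    using q A unfolding m_def by (simp add: divide_simps) algebra
  finally show ?thesis by (simp only: m_def[abs_def])
qed

lemma dm_r:
  assumes "s \<in> I" "\<rho> > 0"
  shows "((\<lambda>\<rho>. m s \<rho>) has_real_derivative 2 * m s \<rho> / \<rho> - 8 * \<rho> * A s * (m s \<rho>)\<^sup>2) (at \<rho>)"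
proof -
  note q = q_pos[OF assms] and A = A_pos[OF assms(1)]
  have "((\<lambda>\<rho>. \<rho>\<^sup>2 * A s / (2 * (q s \<rho>)\<^sup>2)) has_real_derivative
      (2 * \<rho> * A s * (2 * (q s \<rho>)\<^sup>2) - \<rho>\<^sup>2 * A s * (2 * (2 * q s \<rho> * (2 * \<rho>^3 * (A s)\<^sup>2 / q s \<rho>))))
       / ((2 * (q s \<rho>)\<^sup>2) * (2 * (q s \<rho>)\<^sup>2))) (at \<rho>)"
    using assms q by (auto intro!: derivative_eq_intros dq_r)
  also have "(2 * \<rho> * A s * (2 * (q s \<rho>)\<^sup>2) - \<rho>\<^sup>2 * A s * (2 * (2 * q s \<rho> * (2 * \<rho>^3 * (A s)\<^sup>2 / q s \<rho>))))
       / ((2 * (q s \<rho>)\<^sup>2) * (2 * (q s \<rho>)\<^sup>2)) = 2 * m s \<rho> / \<rho> - 8 * \<rho> * A s * (m s \<rho>)\<^sup>2"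
    using q A assms unfolding m_def by (simp add: divide_simps) algebra
  finally show ?thesis by (simp only: m_def[abs_def])
qed

lemma h_eq: "y \<in> U \<Longrightarrow> h y = slice_metric (q (y $ 1) (y $ 2)) (A (y $ 1)) (a (y $ 1)) (b (y $ 1)) (y $ 2)"
  by (simp add: U_def h q_def)

lemma h_invertible: "y \<in> U \<Longrightarrow> invertible (h y)"
  unfolding invertible_det_nz
  using det_slice_metric[of "q (y $ 1) (y $ 2)" "A (y $ 1)"] A_pos[of "y $ 1"] q_pos[of "y $ 1" "y $ 2"]
  by (simp add: h_eq U_def)

lemma dir_deriv_h:
  assumes x: "x \<in> U"
  defines "s \<equiv> x $ 1" and "\<rho> \<equiv> x $ 2"
  shows "dir_deriv (\<lambda>y. h y $ i $ j) x (axis 1 1) = slice_metric_ds (q s \<rho>) (A s) (a s) (b s) (k s) \<rho> $ i $ j"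
    and "dir_deriv (\<lambda>y. h y $ i $ j) x (axis 2 1) = slice_metric_dr (q s \<rho>) (A s) (a s) (b s) \<rho> $ i $ j"
    and "dir_deriv (\<lambda>y. h y $ i $ j) x (axis 3 1) = 0"
proof -
  have s: "s \<in> I" and r: "\<rho> > 0" using x by (auto simp: U_def s_def \<rho>_def)
  have nz: "A s \<noteq> 0" "q s \<rho> \<noteq> 0" using A_pos[OF s] q_pos[OF s r] by auto
  then have nz2: "(A s)\<^sup>2 \<noteq> 0" by simp
  note D = dir_deriv_slice[OF open_U x, of "\<lambda>y. h y $ i $ j"
    "\<lambda>s \<rho>. slice_metric (q s \<rho>) (A s) (a s) (b s) \<rho> $ i $ j", folded s_def \<rho>_def]
  show "dir_deriv (\<lambda>y. h y $ i $ j) x (axis 3 1) = 0" by (rule D(3)) (simp add: h_eq)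
  \<comment> \<open>The terms with k cancel, so the sum is differentiated as a whole, as in the (1,
    1) entry of \<open>slice_metric_ds\<close>.\<close>
  have ab': "((\<lambda>s. (a s)\<^sup>2 + (b s)\<^sup>2) has_real_derivative 2 * a s) (at s)"
    by (rule derivative_eq_intros da db s refl)+ (simp add: algebra_simps)
  have "((\<lambda>s. slice_metric (q s \<rho>) (A s) (a s) (b s) \<rho> $ i $ j) has_real_derivative
     slice_metric_ds (q s \<rho>) (A s) (a s) (b s) (k s) \<rho> $ i $ j) (at s)"
  proof (rule exhaust_3_sym[of _ i j], goal_cases)
    case (7 i j)
    then show ?case by (simp add: slice_metric_sym[of _ _ _ _ _ j i] slice_metric_ds_sym[of _ _ _ _ _ _ j i])
  qed (simp only: slice_metric_nth slice_metric_ds_def Let_def vector_3;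
    (rule ab' derivative_eq_intros dA[OF s] da[OF s] db[OF s] dq_s[OF s r] refl nz nz2)+;
    (insert nz, simp add: divide_simps; algebra)?)+
  then show "dir_deriv (\<lambda>y. h y $ i $ j) x (axis 1 1) = slice_metric_ds (q s \<rho>) (A s) (a s) (b s) (k s) \<rho> $ i $ j"
    by (intro D(1)) (simp_all add: h_eq)
  have "((\<lambda>\<rho>. slice_metric (q s \<rho>) (A s) (a s) (b s) \<rho> $ i $ j) has_real_derivative
     slice_metric_dr (q s \<rho>) (A s) (a s) (b s) \<rho> $ i $ j) (at \<rho>)"
  proof (rule exhaust_3_sym[of _ i j], goal_cases)
    case (7 i j)
    then show ?case by (simp add: slice_metric_sym[of _ _ _ _ _ j i] slice_metric_dr_sym[of _ _ _ _ _ j i])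
  qed (simp only: slice_metric_nth slice_metric_dr_def Let_def vector_3;
    (rule derivative_eq_intros dq_r[OF s r] refl nz nz2)+;
    (insert nz, simp add: divide_simps; algebra)?)+
  then show "dir_deriv (\<lambda>y. h y $ i $ j) x (axis 2 1) = slice_metric_dr (q s \<rho>) (A s) (a s) (b s) \<rho> $ i $ j"
    by (intro D(2)) (simp_all add: h_eq)
qed

lemma christoffel_h:
  assumes x: "x \<in> U"
  defines "s \<equiv> x $ 1" and "\<rho> \<equiv> x $ 2"
  shows "christoffel h c i j x = slice_chr (m s \<rho>) (A s) (a s) (b s) (k s) \<rho> $ c $ i $ j"
proof -
  have s: "s \<in> I" and r: "\<rho> > 0" using x by (auto simp: U_def s_def \<rho>_def)
  let ?d = "vector [slice_metric_ds (q s \<rho>) (A s) (a s) (b s) (k s) \<rho>,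
       slice_metric_dr (q s \<rho>) (A s) (a s) (b s) \<rho>, 0] :: real^3^3^3"
  let ?C = "\<lambda>c. slice_chr (m s \<rho>) (A s) (a s) (b s) (k s) \<rho> $ c $ i $ j"
  have d: "dir_deriv (\<lambda>y. h y $ i $ j) x (axis l 1) = ?d $ l $ i $ j" for i j l
    using exhaust_3[of l] dir_deriv_h[OF x, of i j] by (auto simp: s_def \<rho>_def)
  have "(\<Sum>c\<in>UNIV. h x $ l $ c * ?C c) = (?d $ i $ j $ l + ?d $ j $ i $ l - ?d $ l $ i $ j) / 2" for l
    unfolding h_eq[OF x] s_def[symmetric] \<rho>_def[symmetric]
    using A_pos[OF s] r q_pos[OF s r] ab[OF s] by (rule slice_compatible) (rule m_def)
  then have "christoffel h c i j x = (\<Sum>l\<in>UNIV. matrix_inv (h x) $ c $ l * (\<Sum>c\<in>UNIV. h x $ l $ c * ?C c))"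
    by (simp only: christoffel_def d sum_divide_distrib times_divide_eq_right)
  then show ?thesis unfolding matrix_inv_sandwich[OF h_invertible[OF x]] .
qed

lemma dir_deriv_christoffel:
  assumes x: "x \<in> U"
  defines "s \<equiv> x $ 1" and "\<rho> \<equiv> x $ 2"
  shows "i \<noteq> 1 \<or> j \<noteq> 1 \<Longrightarrow> dir_deriv (christoffel h c i j) x (axis 1 1)
       = slice_chr_ds (m s \<rho>) (A s) (a s) (b s) (k s) \<rho> $ c $ i $ j"
    and "dir_deriv (christoffel h c i j) x (axis 2 1)
       = slice_chr_dr (m s \<rho>) (A s) (a s) (b s) (k s) \<rho> $ c $ i $ j"
    and "dir_deriv (christoffel h c i j) x (axis 3 1) = 0"
proof -
  have s: "s \<in> I" and r: "\<rho> > 0" using x by (auto simp: U_def s_def \<rho>_def)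
  have nz: "A s \<noteq> 0" "\<rho> \<noteq> 0" using A_pos[OF s] r by auto
  then have nz2: "(A s)\<^sup>2 \<noteq> 0" "\<rho> * A s \<noteq> 0" by simp_all
  note D = dir_deriv_slice[OF open_U x, of "christoffel h c i j"
    "\<lambda>s \<rho>. slice_chr (m s \<rho>) (A s) (a s) (b s) (k s) \<rho> $ c $ i $ j", folded s_def \<rho>_def]
  show "dir_deriv (christoffel h c i j) x (axis 3 1) = 0" by (rule D(3)) (simp add: christoffel_h)
  have "\<forall>c. ((\<lambda>\<rho>. slice_chr (m s \<rho>) (A s) (a s) (b s) (k s) \<rho> $ c $ i $ j) has_real_derivative
     slice_chr_dr (m s \<rho>) (A s) (a s) (b s) (k s) \<rho> $ c $ i $ j) (at \<rho>)"
  proof (rule exhaust_3_sym[of _ i j], goal_cases)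
    case (7 i j)
    then show ?case by (simp add: slice_chr_sym[of _ _ _ _ _ _ _ j i] slice_chr_dr_sym[of _ _ _ _ _ _ _ j i])
  qed (simp only: forall_3 slice_chr_def slice_chr_dr_def Let_def vector_3; intro conjI;
    (rule derivative_eq_intros dm_r[OF s r] refl nz nz2)+;
    (insert nz, simp add: divide_simps; algebra)?)+
  then show "dir_deriv (christoffel h c i j) x (axis 2 1)
       = slice_chr_dr (m s \<rho>) (A s) (a s) (b s) (k s) \<rho> $ c $ i $ j"
    by (intro D(2)) (simp_all add: christoffel_h)
  assume ij: "i \<noteq> 1 \<or> j \<noteq> 1"
  \<comment> \<open>As an implication the claim is symmetric in i and j, as
    \<open>exhaust_3_sym\<close> demands, and the pair (1, 1) becomes vacuous.\<close>
  have "i \<noteq> 1 \<or> j \<noteq> 1 \<longrightarrow> (\<forall>c. ((\<lambda>s. slice_chr (m s \<rho>) (A s) (a s) (b s) (k s) \<rho> $ c $ i $ j) has_real_derivative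
     slice_chr_ds (m s \<rho>) (A s) (a s) (b s) (k s) \<rho> $ c $ i $ j) (at s))"
  proof (rule exhaust_3_sym[of _ i j], goal_cases)
    case (7 i j)
    then show ?case by (auto simp: slice_chr_sym[of _ _ _ _ _ _ _ j i] slice_chr_ds_sym[of _ _ _ _ _ _ _ j i])
  next
    case 1
    then show ?case by simp
  qed (intro impI; thin_tac "_ \<or> _"; simp only: forall_3 slice_chr_def slice_chr_ds_def Let_def vector_3; intro conjI;
    (rule derivative_eq_intros dm_s[OF s r] dA[OF s] da[OF s] db[OF s] refl nz nz2)+;
    (insert nz, simp add: divide_simps; algebra)?)+
  with ij show "dir_deriv (christoffel h c i j) x (axis 1 1)
       = slice_chr_ds (m s \<rho>) (A s) (a s) (b s) (k s) \<rho> $ c $ i $ j"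
    by (intro D(1)) (simp_all add: christoffel_h)
qed

lemma ricci_matrix_h:
  assumes x: "x \<in> U"
  defines "s \<equiv> x $ 1" and "\<rho> \<equiv> x $ 2"
  shows "ricci_matrix h x = slice_ricci (m s \<rho>) (A s) (a s) (b s) \<rho>"
proof -
  have s: "s \<in> I" and r: "\<rho> > 0" using x by (auto simp: U_def s_def \<rho>_def)
  let ?d = "vector [slice_chr_ds (m s \<rho>) (A s) (a s) (b s) (k s) \<rho>,
       slice_chr_dr (m s \<rho>) (A s) (a s) (b s) (k s) \<rho>, 0] :: real^3^3^3^3"
  let ?C = "slice_chr (m s \<rho>) (A s) (a s) (b s) (k s) \<rho>"
  have d: "dir_deriv (christoffel h c i j) x (axis l 1) = ?d $ l $ c $ i $ j"
    if "l = 1 \<longrightarrow> i \<noteq> 1 \<or> j \<noteq> 1" for c i j l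
    using exhaust_3[of l] dir_deriv_christoffel[OF x, where i=i and j=j and c=c] that by (auto simp: s_def \<rho>_def)
  have R: "riemann h i l i j x = (if i = j then 0 else ?d $ i $ i $ j $ l - ?d $ j $ i $ i $ l)
       + (\<Sum>c\<in>UNIV. ?C $ i $ i $ c * ?C $ c $ j $ l - ?C $ i $ j $ c * ?C $ c $ i $ l)" for i j l
  \<comment> \<open>For i = j the two derivative terms are the same expression and cancel
    unevaluated. An s-derivative of a symbol with lower indices (1, 1) would force i = j = 1, so the
    table applies in the other case.\<close>
  proof (cases "i = j")
    case True
    then show ?thesis by (simp add: riemann_def christoffel_h[OF x] s_def \<rho>_def)
  next
    case False
    then have "dir_deriv (christoffel h i j l) x (axis i 1) = ?d $ i $ i $ j $ l"
      "dir_deriv (christoffel h i i l) x (axis j 1) = ?d $ j $ i $ i $ l"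
      by (auto intro!: d)
    with False show ?thesis by (simp add: riemann_def christoffel_h[OF x] s_def \<rho>_def)
  qed
  show ?thesis
    unfolding ricci_matrix_def R slice_ricci_eq[OF A_pos[OF s] r ab[OF s]] by (simp add: vec_eq_iff)
qed

end

section \<open>The frame\<close>

text \<open>If the columns of M are the frame, orthonormality says that the transpose of M times G
  times M is the identity; so G is invertible with inverse M times its transpose.\<close>

lemma scalar_curvature_frame:
  fixes G :: "real^'n::finite \<Rightarrow> real^'n^'n" and Y :: "'n \<Rightarrow> real^'n"
  assumes orth: "\<And>i j. metric_form G x (Y i) (Y j) = (if i = j then 1 else 0)"
  shows "scalar_curvature G x = (\<Sum>i\<in>UNIV. ricci G x (Y i) (Y i))"
proof -
  define M :: "real^'n^'n" where "M = (\<chi> l i. Y i $ l)"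
  have "(transpose M ** (G x ** M)) $ i $ j = metric_form G x (Y i) (Y j)" for i j
    by (simp add: metric_form_def matrix_matrix_mult_def transpose_def M_def sum_distrib_left mult_ac)
  then have "transpose M ** (G x ** M) = mat 1"
    by (simp add: orth vec_eq_iff mat_def)
  then have "(G x ** M) ** transpose M = mat 1"
    by (simp add: matrix_left_right_inverse)
  then have GB: "G x ** (M ** transpose M) = mat 1" by (simp add: matrix_mul_assoc)
  then have "invertible (G x)"
    unfolding invertible_def using matrix_left_right_inverse by blast
  then have "matrix_inv (G x) = M ** transpose M"
    using matrix_inv_left GB by (metis matrix_mul_assoc matrix_mul_lid matrix_mul_rid)
  then have inv: "matrix_inv (G x) $ j $ l = (\<Sum>i\<in>UNIV. Y i $ j * Y i $ l)" for j l
    by (simp add: matrix_matrix_mult_def transpose_def M_def)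
  have "scalar_curvature G x =
      (\<Sum>j\<in>UNIV. \<Sum>l\<in>UNIV. \<Sum>i\<in>UNIV. ricci_matrix G x $ j $ l * Y i $ j * Y i $ l)"
    unfolding scalar_curvature_def inv by (simp add: sum_distrib_left sum_distrib_right mult_ac)
  also have "\<dots> = (\<Sum>j\<in>UNIV. \<Sum>i\<in>UNIV. \<Sum>l\<in>UNIV. ricci_matrix G x $ j $ l * Y i $ j * Y i $ l)"
    by (intro sum.cong refl sum.swap)
  also have "\<dots> = (\<Sum>i\<in>UNIV. ricci G x (Y i) (Y i))"
    unfolding ricci_def by (rule sum.swap)
  finally show ?thesis .
qed

text \<open>Rows are the frame vectors, with \<sigma> = 1 / sqrt h22. They are dual, up to scaling,
  to du, \<beta>, \<alpha> in this order; the third row spans the common kernel of du and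
  \<beta>.\<close>

definition slice_frame :: "real \<Rightarrow> real \<Rightarrow> real \<Rightarrow> real \<Rightarrow> real \<Rightarrow> real \<Rightarrow> real^3^3"
  where "slice_frame \<sigma> q A a b \<rho> = vector [vector [0, \<sigma>, 0], vector [0, 0, \<sigma> / \<rho>],
     vector [\<rho> * A\<^sup>2 * \<sigma> / q, - (a * \<rho>\<^sup>2 * A * \<sigma> / q), - (\<rho> * A * b * \<sigma> / q)]]"

lemma slice_frame_orthonormal:
  fixes q A a b \<rho> \<sigma> :: real
  assumes "A > 0" "\<rho> > 0" "q > 0" and ab: "a\<^sup>2 + b\<^sup>2 = A - 1"
    and \<sigma>: "\<sigma>\<^sup>2 = q / (2 * \<rho>\<^sup>2 * A\<^sup>2)"
  defines "Y \<equiv> slice_frame \<sigma> q A a b \<rho>"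
  shows "(\<Sum>c\<in>UNIV. \<Sum>d\<in>UNIV. slice_metric q A a b \<rho> $ c $ d * Y $ i $ c * Y $ j $ d)
     = (if i = j then 1 else 0)"
proof -
  \<comment> \<open>Eliminating q in favour of \<sigma> removes the square root and leaves rational
    identities.\<close>
  have q: "q = 2 * \<rho>\<^sup>2 * A\<^sup>2 * \<sigma>\<^sup>2" using assms by simp
  then have nz: "A \<noteq> 0" "\<rho> \<noteq> 0" "\<sigma> \<noteq> 0" using assms(1-3) by auto
  show ?thesis
  proof (rule exhaust_3_sym[of _ i j], goal_cases)
    case (7 i j)
    then show ?case
      by (subst sum.swap) (simp add: slice_metric_sym[of _ _ _ _ _ _ ] mult_ac eq_commute[of j i])
  qed (use nz in \<open>simp add: q Y_def slice_frame_def slice_metric_nth sum_3 divide_simps; algebra?\<close>)+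
qed

lemma slice_frame_ricci:
  fixes q A a b \<rho> \<sigma> T :: real
  assumes "A > 0" "\<rho> > 0" "q > 0" and ab: "a\<^sup>2 + b\<^sup>2 = A - 1"
    and \<sigma>: "\<sigma>\<^sup>2 = q / (2 * \<rho>\<^sup>2 * A\<^sup>2)"
    and T: "q\<^sup>2 = \<rho>^4 * A\<^sup>2 + T"
    and m: "m = \<rho>\<^sup>2 * A / (2 * q\<^sup>2)"
  defines "Y \<equiv> slice_frame \<sigma> q A a b \<rho>"
  shows "(\<Sum>c\<in>UNIV. \<Sum>d\<in>UNIV. slice_ricci m A a b \<rho> $ c $ d * Y $ i $ c * Y $ j $ d)
     = (vector [vector [2 * T, 0, 0], vector [0, 2 * T - \<rho>^4 * A\<^sup>2, 0],
           vector [0, 0, - 4 * T - \<rho>^4 * A\<^sup>2]] :: real^3^3) $ i $ j / (2 * q^3)"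
proof -
  have q: "q = 2 * \<rho>\<^sup>2 * A\<^sup>2 * \<sigma>\<^sup>2" using assms by simp
  then have nz: "A \<noteq> 0" "\<rho> \<noteq> 0" "\<sigma> \<noteq> 0" using assms(1-3) by auto
  \<comment> \<open>T stands for t^4; it is eliminated first, then q through \<sigma>.\<close>
  have T: "T = q\<^sup>2 - \<rho>^4 * A\<^sup>2" using T by simp
  have sym: "slice_ricci m A a b \<rho> $ c $ d = slice_ricci m A a b \<rho> $ d $ c" for c d
    by (rule exhaust_3_sym; simp add: slice_ricci_def Let_def)
  show ?thesis
  proof (rule exhaust_3_sym[of _ i j], goal_cases)
    case (7 i j)
    have "(vector [vector [p, 0, 0], vector [0, p', 0], vector [0, 0, p'']] :: real^3^3) $ i $ j
        = vector [vector [p, 0, 0], vector [0, p', 0], vector [0, 0, p'']] $ j $ i" for p p' p''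
      by (rule exhaust_3_sym[of _ i j]; simp)
    with 7 show ?case
      by (subst sum.swap) (simp add: sym mult_ac)
  qed (use nz in \<open>simp add: q Y_def slice_frame_def slice_ricci_def Let_def m T sum_3 divide_simps; algebra?\<close>)+
qed

section \<open>Unit speed curves\<close>

lemma smooth_on_has_vector_derivative:
  assumes "smooth_on I c" "s \<in> I"
  shows "(c has_vector_derivative vector_derivative c (at s)) (at s)"
    and "((\<lambda>s. vector_derivative c (at s)) has_vector_derivative
        vector_derivative (\<lambda>s. vector_derivative c (at s)) (at s)) (at s)"
proof -
  have D: "((\<lambda>f s. vector_derivative f (at s)) ^^ n) c differentiable (at s)" for n
    using assms by (simp add: smooth_on_def)
  from D[of 0] D[of 1]
  show "(c has_vector_derivative vector_derivative c (at s)) (at s)"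
    "((\<lambda>s. vector_derivative c (at s)) has_vector_derivative
        vector_derivative (\<lambda>s. vector_derivative c (at s)) (at s)) (at s)"
    by (simp_all add: vector_derivative_works)
qed

lemma has_vector_derivative_Re_Im:
  assumes "(\<Gamma> has_vector_derivative D) (at s)"
  shows "((\<lambda>s. Re (\<Gamma> s)) has_real_derivative Re D) (at s)"
    and "((\<lambda>s. Im (\<Gamma> s)) has_real_derivative Im D) (at s)"
  using bounded_linear.has_vector_derivative[OF bounded_linear_Re assms]
    bounded_linear.has_vector_derivative[OF bounded_linear_Im assms]
  by (simp_all add: has_real_derivative_iff_has_vector_derivative)

locale unit_speed_curve =
  fixes t :: real and I :: "real set" and \<Gamma> :: "real \<Rightarrow> complex"
  assumes open_I: "open I" and smooth: "smooth_on I \<Gamma>"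
    and arclength: "\<And>s. s \<in> I \<Longrightarrow> (deriv (\<lambda>s. Re (\<Gamma> s)) s)\<^sup>2 + (deriv (\<lambda>s. Im (\<Gamma> s)) s)\<^sup>2 = 1"
begin

definition \<Gamma>1 :: "real \<Rightarrow> complex" where "\<Gamma>1 s = vector_derivative \<Gamma> (at s)"
definition \<Gamma>2 :: "real \<Rightarrow> complex" where "\<Gamma>2 s = vector_derivative \<Gamma>1 (at s)"

lemma d\<Gamma>:
  assumes "s \<in> I"
  shows "(\<Gamma> has_vector_derivative \<Gamma>1 s) (at s)" "(\<Gamma>1 has_vector_derivative \<Gamma>2 s) (at s)"
  using smooth_on_has_vector_derivative[OF smooth assms] unfolding \<Gamma>2_def \<Gamma>1_def[abs_def] by auto

lemmas dRI = has_vector_derivative_Re_Im[OF d\<Gamma>(1)] has_vector_derivative_Re_Im[OF d\<Gamma>(2)]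

lemma unit_speed: "s \<in> I \<Longrightarrow> (Re (\<Gamma>1 s))\<^sup>2 + (Im (\<Gamma>1 s))\<^sup>2 = 1"
  using arclength[of s] DERIV_imp_deriv[OF dRI(1)] DERIV_imp_deriv[OF dRI(2)] by simp

text \<open>Obtained by differentiating |\<Gamma>'|^2 = 1; equivalent to \<Gamma>'' = \<i> k
  \<Gamma>' with k real.\<close>

lemma acceleration_normal:
  assumes s: "s \<in> I"
  shows "Re (\<Gamma>1 s) * Re (\<Gamma>2 s) + Im (\<Gamma>1 s) * Im (\<Gamma>2 s) = 0"
proof -
  have "((\<lambda>s. (Re (\<Gamma>1 s))\<^sup>2 + (Im (\<Gamma>1 s))\<^sup>2) has_real_derivative
      2 * (Re (\<Gamma>1 s) * Re (\<Gamma>2 s) + Im (\<Gamma>1 s) * Im (\<Gamma>2 s))) (at s)"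
    by (rule derivative_eq_intros dRI(3)[OF s] dRI(4)[OF s] refl)+ simp
  moreover have "((\<lambda>s. (Re (\<Gamma>1 s))\<^sup>2 + (Im (\<Gamma>1 s))\<^sup>2) has_real_derivative 0) (at s)"
    using unit_speed by (intro has_field_derivative_transform_within_open[OF DERIV_const[of 1] open_I s]) auto
  ultimately show ?thesis using DERIV_unique by fastforce
qed

text \<open>The fourth function is the signed curvature, as |\<Gamma>'| = 1. All data come from
  \<Gamma> and its derivatives, so points with \<Gamma> = 0 need no special treatment.\<close>

sublocale slice t I "\<lambda>s. (cmod (\<Gamma> s))\<^sup>2 + 1" "\<lambda>s. Re (\<Gamma>1 s * cnj (\<Gamma> s))" "\<lambda>s. Im (\<Gamma>1 s * cnj (\<Gamma> s))"
  "\<lambda>s. Im (\<Gamma>2 s * cnj (\<Gamma>1 s))" "induced_metric t \<Gamma>"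
proof
  fix s assume s: "s \<in> I"
  note d = dRI(1)[OF s] dRI(2)[OF s] dRI(3)[OF s] dRI(4)[OF s]
  note n = unit_speed[OF s] acceleration_normal[OF s]
  show "((\<lambda>s. (cmod (\<Gamma> s))\<^sup>2 + 1) has_real_derivative 2 * Re (\<Gamma>1 s * cnj (\<Gamma> s))) (at s)"
    unfolding cmod_power2 by (rule d derivative_eq_intros refl)+ simp
  show "((\<lambda>s. Re (\<Gamma>1 s * cnj (\<Gamma> s))) has_real_derivative
      1 - Im (\<Gamma>2 s * cnj (\<Gamma>1 s)) * Im (\<Gamma>1 s * cnj (\<Gamma> s))) (at s)"
    unfolding times_complex.sel cnj.sel
    by (rule d derivative_eq_intros refl)+ (insert n, simp, algebra)
  show "((\<lambda>s. Im (\<Gamma>1 s * cnj (\<Gamma> s))) has_real_derivative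
      Im (\<Gamma>2 s * cnj (\<Gamma>1 s)) * Re (\<Gamma>1 s * cnj (\<Gamma> s))) (at s)"
    unfolding times_complex.sel cnj.sel
    by (rule d derivative_eq_intros refl)+ (insert n, simp, algebra)
  show "(Re (\<Gamma>1 s * cnj (\<Gamma> s)))\<^sup>2 + (Im (\<Gamma>1 s * cnj (\<Gamma> s)))\<^sup>2 = (cmod (\<Gamma> s))\<^sup>2 + 1 - 1"
    using n(1) unfolding cmod_power2 by (simp, algebra)
next
  fix y :: "real^3" assume y: "y $ 1 \<in> I" "y $ 2 > 0"
  have "cmod (\<Gamma>1 (y $ 1)) = 1" using unit_speed[OF y(1)] by (simp add: cmod_def)
  from induced_metric_eq[where \<Gamma>'="\<Gamma>1 (y $ 1)", OF d\<Gamma>(1)[OF y(1)] this y(2)]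
  show "induced_metric t \<Gamma> y = slice_metric (sqrt ((y $ 2)^4 * ((cmod (\<Gamma> (y $ 1)))\<^sup>2 + 1)\<^sup>2 + t^4))
      ((cmod (\<Gamma> (y $ 1)))\<^sup>2 + 1) (Re (\<Gamma>1 (y $ 1) * cnj (\<Gamma> (y $ 1))))
      (Im (\<Gamma>1 (y $ 1) * cnj (\<Gamma> (y $ 1)))) (y $ 2)" .
qed (rule open_I)

text \<open>From \<Gamma>' = (r' + \<i> r \<theta>') e^(\<i> \<theta>). This links a and b to h12
  and h13 in the frame, whatever the sign of r.\<close>

lemma polar_velocity:
  assumes smooth: "smooth_on I r" "smooth_on I \<theta>"
    and polar: "\<And>s. s \<in> I \<Longrightarrow> \<Gamma> s = complex_of_real (r s) * cis (\<theta> s)"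
    and s: "s \<in> I"
  shows "\<Gamma>1 s * cnj (\<Gamma> s) = Complex (r s * deriv r s) (deriv \<theta> s * (r s)\<^sup>2)"
proof -
  have dr: "(r has_real_derivative deriv r s) (at s)" "(\<theta> has_real_derivative deriv \<theta> s) (at s)"
    using smooth_on_has_vector_derivative(1)[OF smooth(1) s] smooth_on_has_vector_derivative(1)[OF smooth(2) s]
    unfolding has_real_derivative_iff_has_vector_derivative[symmetric]
    by (simp_all add: DERIV_imp_deriv)
  have "((\<lambda>s. r s * cos (\<theta> s)) has_real_derivative deriv r s * cos (\<theta> s) - r s * deriv \<theta> s * sin (\<theta> s)) (at s)"
    by (rule derivative_eq_intros dr refl)+ simp
  then have "((\<lambda>s. Re (\<Gamma> s)) has_real_derivative deriv r s * cos (\<theta> s) - r s * deriv \<theta> s * sin (\<theta> s)) (at s)"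
    by (rule has_field_derivative_transform_within_open[OF _ open_I s]) (simp add: polar)
  then have x: "Re (\<Gamma>1 s) = deriv r s * cos (\<theta> s) - r s * deriv \<theta> s * sin (\<theta> s)"
    using dRI(1)[OF s] DERIV_unique by blast
  have "((\<lambda>s. r s * sin (\<theta> s)) has_real_derivative deriv r s * sin (\<theta> s) + r s * deriv \<theta> s * cos (\<theta> s)) (at s)"
    by (rule derivative_eq_intros dr refl)+ simp
  then have "((\<lambda>s. Im (\<Gamma> s)) has_real_derivative deriv r s * sin (\<theta> s) + r s * deriv \<theta> s * cos (\<theta> s)) (at s)"
    by (rule has_field_derivative_transform_within_open[OF _ open_I s]) (simp add: polar)
  then have y: "Im (\<Gamma>1 s) = deriv r s * sin (\<theta> s) + r s * deriv \<theta> s * cos (\<theta> s)"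
    using dRI(2)[OF s] DERIV_unique by blast
  have "(sin (\<theta> s))\<^sup>2 + (cos (\<theta> s))\<^sup>2 = 1" by simp
  then show ?thesis
    unfolding complex_eq_iff times_complex.sel complex.sel complex_cnj polar[OF s] x y cis.sel
    by (simp, algebra)
qed

end

lemma EH_frame_eq:
  fixes x :: "real^3" and t s \<rho> :: real and r \<theta> :: "real \<Rightarrow> real" and \<Gamma> :: "real \<Rightarrow> complex"
  assumes pos: "\<rho> > 0" and x: "x $ 1 = s" "x $ 2 = \<rho>"
  defines "A \<equiv> (r s)\<^sup>2 + 1" and "a \<equiv> r s * deriv r s" and "b \<equiv> deriv \<theta> s * (r s)\<^sup>2"
  defines "q \<equiv> sqrt (\<rho>^4 * A\<^sup>2 + t^4)"
  defines "\<sigma> \<equiv> 1 / sqrt (2 * \<rho>\<^sup>2 * A\<^sup>2 / q)"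
  assumes h: "induced_metric t \<Gamma> x = slice_metric q A a b \<rho>"
  shows "EH_frame t \<Gamma> r \<theta> x i = slice_frame \<sigma> q A a b \<rho> $ i"
proof -
  have A: "A > 0" by (simp add: A_def add_nonneg_pos)
  have "\<rho>^4 * A\<^sup>2 > 0" using A pos by simp
  then have q: "q > 0" by (simp add: q_def add_pos_nonneg)
  define w where "w = sqrt (2 * \<rho>\<^sup>2 * A\<^sup>2 / q)"
  have w: "w > 0" "w\<^sup>2 = 2 * \<rho>\<^sup>2 * A\<^sup>2 / q" using A pos q by (auto simp: w_def)
  have K: "EH_K t r s \<rho> = 2 * \<rho>\<^sup>2 * A / q" by (simp add: EH_K_def A_def q_def)
  have h22: "A * EH_K t r s \<rho> = w\<^sup>2" unfolding w(2) K by (simp add: power2_eq_square)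
  have s22: "sqrt (A * EH_K t r s \<rho>) = w" using w(1) by (simp add: h22)
  have "\<rho>\<^sup>2 * A * EH_K t r s \<rho> = (\<rho> * w)\<^sup>2" using h22 by (simp add: power_mult_distrib)
  then have s33: "sqrt (\<rho>\<^sup>2 * A * EH_K t r s \<rho>) = \<rho> * w" using w(1) pos by simp
  \<comment> \<open>With w = sqrt h22 the determinant is a perfect square, which gives \<Sigma> = 1
    / (2 \<rho> w).\<close>
  have "det (induced_metric t \<Gamma> x) = (2 * \<rho>\<^sup>2 * w)\<^sup>2"
    unfolding h det_slice_metric[OF q A] power_mult_distrib w(2)
    by (simp add: power2_eq_square power4_eq_xxxx numeral_eq_Suc)
  then have sd: "sqrt (det (induced_metric t \<Gamma> x)) = 2 * \<rho>\<^sup>2 * w" using w(1) by simp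
  have q': "q = 2 * \<rho>\<^sup>2 * A\<^sup>2 / w\<^sup>2" using w A pos q by (simp add: field_simps)
  have \<sigma>: "\<sigma> = 1 / w" by (simp add: \<sigma>_def w_def)
  have nz: "w \<noteq> 0" "\<rho> \<noteq> 0" "A \<noteq> 0" using w pos A by auto
  consider "i = 1" | "i = 2" | "i = 3" using exhaust_3 by auto
  then show ?thesis
    unfolding EH_frame_def Let_def x A_def[symmetric] s22 s33 sd h22 unfolding K
    using nz w(1)
    by cases (simp_all add: vec_eq_iff forall_3 axis_def slice_frame_def \<sigma> q' a_def b_def divide_simps power2_eq_square)
qed

theorem theorem1:
  fixes t :: real and I :: "real set" and \<Gamma> :: "real \<Rightarrow> complex"
    and r \<phi>\<^sub>\<Gamma> :: "real \<Rightarrow> real" and s \<rho> \<phi> :: real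
  assumes "t > 0"
    and "open I" and "is_interval I"
    and "smooth_on I \<Gamma>" and "smooth_on I r" and "smooth_on I \<phi>\<^sub>\<Gamma>"
    and polar: "\<And>s. s \<in> I \<Longrightarrow> \<Gamma> s = complex_of_real (r s) * cis (\<phi>\<^sub>\<Gamma> s)"
    and arclength: "\<And>s. s \<in> I \<Longrightarrow> (deriv (\<lambda>s. Re (\<Gamma> s)) s)\<^sup>2 + (deriv (\<lambda>s. Im (\<Gamma> s)) s)\<^sup>2 = 1"
    and "s \<in> I" and "\<rho> > 0"
  defines "h \<equiv> induced_metric t \<Gamma>"
    and "x \<equiv> vector [s, \<rho>, \<phi>] :: real^3"
    and "Y \<equiv> EH_frame t \<Gamma> r \<phi>\<^sub>\<Gamma>"
    and "P \<equiv> \<rho>^4 * ((r s)\<^sup>2 + 1)\<^sup>2"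
  shows "(\<forall>i j. metric_form h x (Y x i) (Y x j) = (if i = j then 1 else 0))
    \<and> (\<chi> i j. ricci h x (Y x i) (Y x j)) =
        (1 / (2 * (P + t^4) powr (3/2))) *\<^sub>R
          (vector [vector [2 * t^4, 0, 0],
                   vector [0, 2 * t^4 - P, 0],
                   vector [0, 0, - 4 * t^4 - P]] :: real^3^3)
    \<and> scalar_curvature h x = - P / (P + t^4) powr (3/2)"
proof -
  interpret unit_speed_curve t I \<Gamma>
    using assms(2,4) arclength by unfold_locales
  define A a b where "A = (r s)\<^sup>2 + 1" and "a = r s * deriv r s" and "b = deriv \<phi>\<^sub>\<Gamma> s * (r s)\<^sup>2"
  have norm: "(cmod (\<Gamma> s))\<^sup>2 + 1 = A"
    using polar[OF \<open>s \<in> I\<close>] by (simp add: A_def norm_mult)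
  have vel: "\<Gamma>1 s * cnj (\<Gamma> s) = Complex (r s * deriv r s) (deriv \<phi>\<^sub>\<Gamma> s * (r s)\<^sup>2)"
    by (rule polar_velocity[OF assms(5,6) polar \<open>s \<in> I\<close>])
  have a: "Re (\<Gamma>1 s * cnj (\<Gamma> s)) = a" and b: "Im (\<Gamma>1 s * cnj (\<Gamma> s)) = b"
    unfolding vel by (simp_all add: a_def b_def)
  have x: "x $ 1 = s" "x $ 2 = \<rho>" by (simp_all add: x_def)
  have U: "x \<in> U" using \<open>s \<in> I\<close> \<open>\<rho> > 0\<close> by (simp add: U_def x)
  define Q where "Q = sqrt (P + t^4)"
  have q: "q s \<rho> = Q" by (simp add: q_def norm Q_def P_def A_def)
  define M where "M = \<rho>\<^sup>2 * A / (2 * Q\<^sup>2)"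
  have m: "m s \<rho> = M" by (simp add: m_def norm q M_def)
  \<comment> \<open>The locale speaks of |\<Gamma>|^2 and \<Gamma>'; \<open>norm\<close>,
    \<open>a\<close> and \<open>b\<close> translate its results into r and \<phi>_\<Gamma>.\<close>
  have hx: "h x = slice_metric Q A a b \<rho>"
    using h_eq[OF U] unfolding x norm a b q h_def .
  have ric: "ricci_matrix h x = slice_ricci M A a b \<rho>"
    using ricci_matrix_h[OF U] unfolding x norm a b m h_def .
  have pos: "A > 0" "Q > 0" using A_pos[OF \<open>s \<in> I\<close>] q_pos[OF \<open>s \<in> I\<close> \<open>\<rho> > 0\<close>] by (simp_all add: norm q)
  have ab': "a\<^sup>2 + b\<^sup>2 = A - 1" using ab[OF \<open>s \<in> I\<close>] unfolding a b norm .
  define \<sigma> where "\<sigma> = 1 / sqrt (2 * \<rho>\<^sup>2 * A\<^sup>2 / Q)"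
  have \<sigma>: "\<sigma>\<^sup>2 = Q / (2 * \<rho>\<^sup>2 * A\<^sup>2)"
    using pos \<open>\<rho> > 0\<close> by (simp add: \<sigma>_def power_divide)
  have QA: "Q = sqrt (\<rho>^4 * A\<^sup>2 + t^4)" by (simp add: Q_def P_def A_def)
  have Y: "Y x i = slice_frame \<sigma> Q A a b \<rho> $ i" for i
    using EH_frame_eq[OF \<open>\<rho> > 0\<close> x, where r=r and \<theta>=\<phi>\<^sub>\<Gamma> and t=t and \<Gamma>=\<Gamma>] hx
    unfolding Y_def h_def \<sigma>_def QA A_def a_def b_def by blast
  have orth: "metric_form h x (Y x i) (Y x j) = (if i = j then 1 else 0)" for i j
    unfolding metric_form_def hx Y by (rule slice_frame_orthonormal[OF pos(1) \<open>\<rho> > 0\<close> pos(2) ab' \<sigma>])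
  have PA: "P = \<rho>^4 * A\<^sup>2" by (simp add: P_def A_def)
  have "P + t^4 > 0" using pos(2) by (simp add: Q_def)
  then have powr: "(P + t^4) powr (3/2) = Q^3"
    by (simp add: Q_def powr_half_sqrt[symmetric] powr_power)
  have Q2: "Q\<^sup>2 = \<rho>^4 * A\<^sup>2 + t^4" using \<open>P + t^4 > 0\<close> by (simp add: Q_def PA)
  have R: "ricci h x (Y x i) (Y x j) = (vector [vector [2 * t^4, 0, 0], vector [0, 2 * t^4 - P, 0],
      vector [0, 0, - 4 * t^4 - P]] :: real^3^3) $ i $ j / (2 * Q^3)" for i j
    unfolding ricci_def ric Y PA
    by (rule slice_frame_ricci[OF pos(1) \<open>\<rho> > 0\<close> pos(2) ab' \<sigma> Q2 M_def])
  have "scalar_curvature h x = (\<Sum>i\<in>UNIV. ricci h x (Y x i) (Y x i))"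
    by (rule scalar_curvature_frame[OF orth])
  \<comment> \<open>In the trace the multiples 2, 2 and -4 of t^4 cancel and -2P remains over 2
    Q^3.\<close>
  also have "\<dots> = - P / Q^3"
    unfolding R sum_3 using pos(2) by (simp add: field_simps)
  finally show ?thesis
    using orth R by (simp add: powr vec_eq_iff)
qed

end
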